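(* Let $n\in\mathbb{N}$, let $M^n$ be an $n$-dimensional $C^\infty$ manifold (analytic if $r=\omega$), let $r\ge 1$ ($r=\infty$ and $r=\omega$ allowed), and let $f:M^n\to M^n$ be a $C^r$ diffeomorphism. If $f$ is $C^r$ integrable, then its cotangent lift, i.e., the $2n$-dimensional symplectic diffeomorphism on $T^*M^n$ given in local coordinates $(x,p)$ by $$x(i+1)=f(x(i)),\qquad p(i)=\mathrm{D}f(x(i))^{T}\,p(i+1),$$ that is, $(x,p)\mapsto\bigl(f(x),(\mathrm{D}f(x)^{T})^{-1}p\bigr)$, is $C^r$ integrable as a symplectic diffeomorphism.
   Context: Definition (integrability of diffeomorphisms). $f:M^n\to M^n$ is $(m,n-m)$-integrable, where $0\le m\le n$, if there exist $m$ vector fields $X_1,\ldots,X_m$ and $n-m$ scalar-valued functions $F_1,\ldots,F_{n-m}$ on $M^n$ such that: (i) $X_1,\dots,X_m$ are linearly independent almost everywhere and commute with each other (vanishing Lie brackets); (ii) $\mathrm{d}F_1,\ldots,\mathrm{d}F_{n-m}$ are linearly independent almost everywhere and $F_1,\ldots,F_{n-m}$ are first integrals of $X_1,\dots,X_m$, i.e., $\mathrm{d}F_k(X_j)\equiv0$; (iii) the flow $\varphi_j^t$ of $X_j$ satisfies $f\circ\varphi_j^t=\varphi_j^t\circ f$ for all $t\in\mathbb{R}$ and all $j$ (flows understood to be defined for all $t\in\mathbb{R}$), and $F_j\circ f=F_j$ for all $j$. $f$ is called integrable if it is $(m,n-m)$-integrable for some $m$, and $C^r$ integrable if the first integrals and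 commutative vector fields as well as $f$ are $C^r$ ($r=\omega$ meaning analytic). Definition (integrability of symplectic diffeomorphisms). Let $(x,p)$ be local coordinates on $T^*M^n$, which carries the canonical symplectic form $\sum_{j=1}^n\mathrm{d}p_j\wedge\mathrm{d}x_j$. A symplectic diffeomorphism $\hat f$ of $T^*M^n$ is $C^r$ integrable if there exist $n$ scalar-valued $C^r$ functions $G_1,\dots,G_n$ of $(x,p)$ which are first integrals of $\hat f$ (i.e., $G_j\circ\hat f=G_j$), whose derivatives are linearly independent almost everywhere, and which are in involution: $$\{G_j,G_k\}:=\mathrm{D}_xG_j^{T}\,\mathrm{D}_pG_k-\mathrm{D}_pG_j^{T}\,\mathrm{D}_xG_k\equiv 0,\quad j,k=1,\dots,n.$$ Here the qualifier $C^r$ refers to the regularity of the functions $G_j$.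
   Formalization: For r = 1 the cotangent lift need not be differentiable, so there it is only shown to be a homeomorphism having the n required C^1 first integrals; that it is a symplectic (C^1) diffeomorphism is asserted for every r other than 1. *)

theory Defs
  imports "HOL-Analysis.Analysis"
begin

section \<open>Regularity classes in Euclidean space\<close>

datatype regularity = C_fin nat | C_infinity | C_omega

text \<open>
  \<open>f\<close> is \<open>k\<close> times continuously differentiable on the open set \<open>S\<close>: all directional
  derivatives of a differentiable \<open>f\<close> are \<open>k - 1\<close> times continuously differentiable.
\<close>

primrec k_times_cont_diff_on ::
    "nat \<Rightarrow> 'e::euclidean_space set \<Rightarrow> ('e \<Rightarrow> 'f::real_normed_vector) \<Rightarrow> bool" where
  "k_times_cont_diff_on 0 S f = continuous_on S f"
| "k_times_cont_diff_on (Suc k) S f =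
    ((\<forall>x\<in>S. f differentiable (at x)) \<and>
     (\<forall>v. k_times_cont_diff_on k S (\<lambda>x. frechet_derivative f (at x) v)))"

text \<open>
  Convergent power series in several variables; a multi-index is a function
  \<open>\<alpha>\<close> on \<open>Basis\<close> (extensional, so that each multi-index is counted once).
\<close>

definition locally_power_series_on ::
    "'e::euclidean_space set \<Rightarrow> ('e \<Rightarrow> 'f::real_normed_vector) \<Rightarrow> bool" where
  "locally_power_series_on S f \<longleftrightarrow>
    (\<forall>a\<in>S. \<exists>\<rho>>0. \<exists>coef. \<forall>x\<in>ball a \<rho>.
      ((\<lambda>\<alpha>::'e \<Rightarrow> nat. (\<Prod>b\<in>Basis. ((x - a) \<bullet> b) ^ \<alpha> b) *\<^sub>R coef \<alpha>) has_sum f x)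
        (Basis \<rightarrow>\<^sub>E UNIV))"

primrec Cr_on ::
    "regularity \<Rightarrow> 'e::euclidean_space set \<Rightarrow> ('e \<Rightarrow> 'f::real_normed_vector) \<Rightarrow> bool" where
  "Cr_on (C_fin k) S f = k_times_cont_diff_on k S f"
| "Cr_on C_infinity S f = (\<forall>k. k_times_cont_diff_on k S f)"
| "Cr_on C_omega S f = ((\<forall>k. k_times_cont_diff_on k S f) \<and> locally_power_series_on S f)"


section \<open>Manifolds\<close>

text \<open>
  A chart is its domain together with its coordinate map (whose values outside the domain are
  irrelevant). A manifold is given by an atlas \<open>A\<close>: the underlying set is the union of the chart
  domains, and the topology is the one in which the chart domains are open and the charts are
  homeomorphisms onto their images.
\<close>

type_synonym ('a, 'e) chart = "'a set \<times> ('a \<Rightarrow> 'e)"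

abbreviation cdom :: "('a, 'e) chart \<Rightarrow> 'a set" where "cdom c \<equiv> fst c"
abbreviation cmap :: "('a, 'e) chart \<Rightarrow> 'a \<Rightarrow> 'e" where "cmap c \<equiv> snd c"
abbreviation cinv :: "('a, 'e) chart \<Rightarrow> 'e \<Rightarrow> 'a" where "cinv c \<equiv> inv_into (cdom c) (cmap c)"

definition underlying_set :: "('a, 'e) chart set \<Rightarrow> 'a set" where
  "underlying_set A = (\<Union>c\<in>A. cdom c)"

definition atlas_topology :: "('a, 'e::euclidean_space) chart set \<Rightarrow> 'a topology" where
  "atlas_topology A =
    topology_generated_by {{q \<in> cdom c. cmap c q \<in> B} | c B. c \<in> A \<and> open B}"

definition manifold :: "regularity \<Rightarrow> ('a, 'e::euclidean_space) chart set \<Rightarrow> bool" where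
  "manifold s A \<longleftrightarrow>
    (\<forall>c\<in>A. inj_on (cmap c) (cdom c) \<and> open (cmap c ` cdom c)) \<and>
    (\<forall>c\<in>A. \<forall>d\<in>A. open (cmap c ` (cdom c \<inter> cdom d)) \<and>
       Cr_on s (cmap c ` (cdom c \<inter> cdom d)) (cmap d \<circ> cinv c)) \<and>
    Hausdorff_space (atlas_topology A) \<and> second_countable (atlas_topology A)"

definition Cr_map :: "regularity \<Rightarrow> ('a, 'e::euclidean_space) chart set \<Rightarrow>
    ('b, 'f::euclidean_space) chart set \<Rightarrow> ('a \<Rightarrow> 'b) \<Rightarrow> bool" where
  "Cr_map r A B g \<longleftrightarrow>
    continuous_map (atlas_topology A) (atlas_topology B) g \<and>
    (\<forall>c\<in>A. \<forall>d\<in>B. Cr_on r (cmap c ` {q \<in> cdom c. g q \<in> cdom d}) (cmap d \<circ> g \<circ> cinv c))"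

definition diffeomorphism :: "regularity \<Rightarrow> ('a, 'e::euclidean_space) chart set \<Rightarrow>
    ('b, 'f::euclidean_space) chart set \<Rightarrow> ('a \<Rightarrow> 'b) \<Rightarrow> bool" where
  "diffeomorphism r A B g \<longleftrightarrow>
    bij_betw g (underlying_set A) (underlying_set B) \<and>
    Cr_map r A B g \<and> Cr_map r B A (inv_into (underlying_set A) g)"

definition Cr_function ::
    "regularity \<Rightarrow> ('a, 'e::euclidean_space) chart set \<Rightarrow> ('a \<Rightarrow> real) \<Rightarrow> bool" where
  "Cr_function r A F \<longleftrightarrow> (\<forall>c\<in>A. Cr_on r (cmap c ` cdom c) (F \<circ> cinv c))"

definition almost_everywhere ::
    "('a, 'e::euclidean_space) chart set \<Rightarrow> ('a \<Rightarrow> bool) \<Rightarrow> bool" where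
  "almost_everywhere A P \<longleftrightarrow> (\<forall>c\<in>A. negligible (cmap c ` {q \<in> cdom c. \<not> P q}))"

definition lin_indep_family :: "nat \<Rightarrow> (nat \<Rightarrow> 'e::real_vector) \<Rightarrow> bool" where
  "lin_indep_family k v \<longleftrightarrow> inj_on v {..<k} \<and> independent (v ` {..<k})"

text \<open>The derivative of a scalar function in a chart, as the vector of its partial derivatives.\<close>

definition coord_grad ::
    "('a, 'e::euclidean_space) chart \<Rightarrow> ('a \<Rightarrow> real) \<Rightarrow> 'a \<Rightarrow> 'e" where
  "coord_grad c F q =
    (\<Sum>b\<in>Basis. frechet_derivative (F \<circ> cinv c) (at (cmap c q)) b *\<^sub>R b)"

definition differentials_independent_ae ::
    "('a, 'e::euclidean_space) chart set \<Rightarrow> nat \<Rightarrow> (nat \<Rightarrow> 'a \<Rightarrow> real) \<Rightarrow> bool" where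
  "differentials_independent_ae A k F \<longleftrightarrow>
    almost_everywhere A
      (\<lambda>q. \<forall>c\<in>A. q \<in> cdom c \<longrightarrow> lin_indep_family k (\<lambda>j. coord_grad c (F j) q))"


section \<open>Vector fields and flows\<close>

definition chart_jacobian :: "('a \<Rightarrow> 'b) \<Rightarrow> ('a, real^'n::finite) chart \<Rightarrow> ('b, real^'n) chart \<Rightarrow> 'a \<Rightarrow>
    real^'n^'n" where
  "chart_jacobian g c d q = matrix (frechet_derivative (cmap d \<circ> g \<circ> cinv c) (at (cmap c q)))"

text \<open>
  A tangent vector at \<open>q\<close> is represented by the family of its component vectors in the
  charts around \<open>q\<close>, related to each other by the Jacobians of the coordinate changes.
\<close>

type_synonym ('a, 'n) vfield = "'a \<Rightarrow> ('a, real^'n) chart \<Rightarrow> real^'n"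

definition vector_field :: "('a, real^'n::finite) chart set \<Rightarrow> ('a, 'n) vfield \<Rightarrow> bool" where
  "vector_field A X \<longleftrightarrow>
    (\<forall>c\<in>A. \<forall>d\<in>A. \<forall>q \<in> cdom c \<inter> cdom d. X q d = chart_jacobian id c d q *v X q c)"

definition Cr_vector_field ::
    "regularity \<Rightarrow> ('a, real^'n::finite) chart set \<Rightarrow> ('a, 'n) vfield \<Rightarrow> bool" where
  "Cr_vector_field r A X \<longleftrightarrow>
    vector_field A X \<and> (\<forall>c\<in>A. Cr_on r (cmap c ` cdom c) (\<lambda>x. X (cinv c x) c))"

definition vector_fields_independent_ae ::
    "('a, real^'n::finite) chart set \<Rightarrow> nat \<Rightarrow> (nat \<Rightarrow> ('a, 'n) vfield) \<Rightarrow> bool" where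
  "vector_fields_independent_ae A k X \<longleftrightarrow>
    almost_everywhere A (\<lambda>q. \<forall>c\<in>A. q \<in> cdom c \<longrightarrow> lin_indep_family k (\<lambda>j. X j q c))"

text \<open>The components of the Lie bracket of \<open>X\<close> and \<open>Y\<close> in the chart \<open>c\<close>.\<close>

definition lie_bracket ::
    "('a, 'n::finite) vfield \<Rightarrow> ('a, 'n) vfield \<Rightarrow> ('a, 'n) vfield" where
  "lie_bracket X Y q c =
    frechet_derivative (\<lambda>x. Y (cinv c x) c) (at (cmap c q)) (X q c) -
    frechet_derivative (\<lambda>x. X (cinv c x) c) (at (cmap c q)) (Y q c)"

text \<open>\<open>dF(X)\<close> at \<open>q\<close>, computed in the chart \<open>c\<close>.\<close>

definition derivation_along ::
    "('a, 'n::finite) vfield \<Rightarrow> ('a \<Rightarrow> real) \<Rightarrow> 'a \<Rightarrow> ('a, real^'n) chart \<Rightarrow> real" where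
  "derivation_along X F q c = frechet_derivative (F \<circ> cinv c) (at (cmap c q)) (X q c)"

text \<open>\<open>\<phi>\<close> is the (complete) flow of \<open>X\<close>.\<close>

definition is_flow ::
    "('a, real^'n::finite) chart set \<Rightarrow> ('a, 'n) vfield \<Rightarrow> (real \<Rightarrow> 'a \<Rightarrow> 'a) \<Rightarrow> bool" where
  "is_flow A X \<phi> \<longleftrightarrow>
    (\<forall>q\<in>underlying_set A.
       \<phi> 0 q = q \<and>
       continuous_map euclideanreal (atlas_topology A) (\<lambda>t. \<phi> t q) \<and>
       (\<forall>t. \<forall>c\<in>A. \<phi> t q \<in> cdom c \<longrightarrow>
          ((\<lambda>s. cmap c (\<phi> s q)) has_vector_derivative X (\<phi> t q) c) (at t)))"


section \<open>Integrability of diffeomorphisms\<close>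

text \<open>
  \<open>(m, n - m)\<close>-integrability with data of class \<open>r\<close>, where \<open>n = CARD('n)\<close>. Flows of fields
  of class at least \<open>C_fin 1\<close> on a Hausdorff manifold are unique.
\<close>

definition Cr_integrable_with ::
    "regularity \<Rightarrow> ('a, real^'n::finite) chart set \<Rightarrow> nat \<Rightarrow> ('a \<Rightarrow> 'a) \<Rightarrow> bool" where
  "Cr_integrable_with r A m f \<longleftrightarrow>
    m \<le> CARD('n) \<and> Cr_map r A A f \<and>
    (\<exists>(X :: nat \<Rightarrow> ('a, 'n) vfield) (F :: nat \<Rightarrow> 'a \<Rightarrow> real).
       (\<forall>j<m. Cr_vector_field r A (X j)) \<and>
       (\<forall>k<CARD('n) - m. Cr_function r A (F k)) \<and>
       vector_fields_independent_ae A m X \<and>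
       (\<forall>i<m. \<forall>j<m. \<forall>c\<in>A. \<forall>q\<in>cdom c. lie_bracket (X i) (X j) q c = 0) \<and>
       differentials_independent_ae A (CARD('n) - m) F \<and>
       (\<forall>k<CARD('n) - m. \<forall>j<m. \<forall>c\<in>A. \<forall>q\<in>cdom c. derivation_along (X j) (F k) q c = 0) \<and>
       (\<forall>j<m. \<exists>\<phi>. is_flow A (X j) \<phi> \<and> (\<forall>t. \<forall>q\<in>underlying_set A. f (\<phi> t q) = \<phi> t (f q))) \<and>
       (\<forall>k<CARD('n) - m. \<forall>q\<in>underlying_set A. F k (f q) = F k q))"

definition Cr_integrable ::
    "regularity \<Rightarrow> ('a, real^'n::finite) chart set \<Rightarrow> ('a \<Rightarrow> 'a) \<Rightarrow> bool" where
  "Cr_integrable r A f \<longleftrightarrow> (\<exists>m. Cr_integrable_with r A m f)"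


section \<open>The cotangent bundle\<close>

text \<open>
  A covector at \<open>q\<close> is represented by the family of its component vectors in the charts around
  \<open>q\<close>, which transform by the transposed Jacobians; the value \<open>0\<close> at all other arguments makes
  the representation unique.
\<close>

type_synonym ('a, 'n) covec = "('a, real^'n) chart \<Rightarrow> real^'n"

definition cotangent_bundle :: "('a, real^'n::finite) chart set \<Rightarrow> ('a \<times> ('a, 'n) covec) set" where
  "cotangent_bundle A = {(q, p). q \<in> underlying_set A \<and>
     (\<forall>c. \<not> (c \<in> A \<and> q \<in> cdom c) \<longrightarrow> p c = 0) \<and>
     (\<forall>c\<in>A. \<forall>d\<in>A. q \<in> cdom c \<inter> cdom d \<longrightarrow> p c = transpose (chart_jacobian id c d q) *v p d)}"

text \<open>The local coordinates \<open>(x, p)\<close> induced by a chart \<open>c\<close>.\<close>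

definition cotangent_chart :: "('a, real^'n::finite) chart set \<Rightarrow> ('a, real^'n) chart \<Rightarrow>
    ('a \<times> ('a, 'n) covec, (real^'n) \<times> (real^'n)) chart" where
  "cotangent_chart A c =
    ({y \<in> cotangent_bundle A. fst y \<in> cdom c}, \<lambda>(q, p). (cmap c q, p c))"

definition cotangent_atlas :: "('a, real^'n::finite) chart set \<Rightarrow>
    ('a \<times> ('a, 'n) covec, (real^'n) \<times> (real^'n)) chart set" where
  "cotangent_atlas A = cotangent_chart A ` A"

text \<open>
  In charts \<open>c\<close> around \<open>q\<close> and \<open>d\<close> around \<open>f q\<close> the cotangent lift is
  \<open>(x, p) \<mapsto> (f x, (Df(x)\<^sup>T)\<^sup>-\<^sup>1 p)\<close>. The result does not depend on the choice of \<open>c\<close>; see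
  \<open>cotangent_lift_coords\<close> and \<open>cotangent_lift_in_bundle\<close> below.
\<close>

definition cotangent_lift :: "('a, real^'n::finite) chart set \<Rightarrow> ('a \<Rightarrow> 'a) \<Rightarrow>
    'a \<times> ('a, 'n) covec \<Rightarrow> 'a \<times> ('a, 'n) covec" where
  "cotangent_lift A f = (\<lambda>(q, p).
     (f q, \<lambda>d. if d \<in> A \<and> f q \<in> cdom d
               then let c = (SOME c. c \<in> A \<and> q \<in> cdom c)
                    in matrix_inv (transpose (chart_jacobian f c d q)) *v p c
               else 0))"

text \<open>The form \<open>\<Sum>j. dp\<^sub>j \<and> dx\<^sub>j\<close> evaluated at two tangent vectors.\<close>

definition canonical_form :: "(real^'n::finite) \<times> (real^'n) \<Rightarrow> (real^'n) \<times> (real^'n) \<Rightarrow> real" where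
  "canonical_form a b = (\<Sum>j\<in>UNIV. snd a $ j * fst b $ j - snd b $ j * fst a $ j)"

definition preserves_canonical_form :: "('a, real^'n::finite) chart set \<Rightarrow>
    ('a \<times> ('a, 'n) covec \<Rightarrow> 'a \<times> ('a, 'n) covec) \<Rightarrow> bool" where
  "preserves_canonical_form A g \<longleftrightarrow>
    (\<forall>c\<in>cotangent_atlas A. \<forall>d\<in>cotangent_atlas A. \<forall>y\<in>cdom c. g y \<in> cdom d \<longrightarrow>
       (let L = frechet_derivative (cmap d \<circ> g \<circ> cinv c) (at (cmap c y))
        in \<forall>a b. canonical_form (L a) (L b) = canonical_form a b))"

definition symplectic_diffeomorphism :: "('a, real^'n::finite) chart set \<Rightarrow>
    ('a \<times> ('a, 'n) covec \<Rightarrow> 'a \<times> ('a, 'n) covec) \<Rightarrow> bool" where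
  "symplectic_diffeomorphism A g \<longleftrightarrow>
    diffeomorphism (C_fin 1) (cotangent_atlas A) (cotangent_atlas A) g \<and>
    preserves_canonical_form A g"

definition poisson_bracket ::
    "('y, (real^'n::finite) \<times> (real^'n)) chart \<Rightarrow> ('y \<Rightarrow> real) \<Rightarrow> ('y \<Rightarrow> real) \<Rightarrow> 'y \<Rightarrow> real" where
  "poisson_bracket c G H y =
    fst (coord_grad c G y) \<bullet> snd (coord_grad c H y) -
    snd (coord_grad c G y) \<bullet> fst (coord_grad c H y)"

text \<open>
  Integrability of a symplectic diffeomorphism \<open>g\<close> of the cotangent bundle. That \<open>g\<close> is
  symplectic is not part of this predicate, because the cotangent lift of a \<open>C_fin 1\<close>
  diffeomorphism is in general only a homeomorphism.
\<close>

definition Cr_symplectic_integrable :: "regularity \<Rightarrow> ('a, real^'n::finite) chart set \<Rightarrow>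
    ('a \<times> ('a, 'n) covec \<Rightarrow> 'a \<times> ('a, 'n) covec) \<Rightarrow> bool" where
  "Cr_symplectic_integrable r A g \<longleftrightarrow>
    (\<exists>G :: nat \<Rightarrow> 'a \<times> ('a, 'n) covec \<Rightarrow> real.
       (\<forall>j<CARD('n). Cr_function r (cotangent_atlas A) (G j)) \<and>
       (\<forall>j<CARD('n). \<forall>y\<in>cotangent_bundle A. G j (g y) = G j y) \<and>
       differentials_independent_ae (cotangent_atlas A) CARD('n) G \<and>
       (\<forall>j<CARD('n). \<forall>k<CARD('n). \<forall>c\<in>cotangent_atlas A. \<forall>y\<in>cdom c.
          poisson_bracket c (G j) (G k) y = 0))"


section \<open>The cotangent lift in arbitrary local coordinates\<close>

lemma Cr_on_continuous:
  assumes "Cr_on r S f"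
  shows "continuous_on S f"
proof -
  obtain k where k: "k_times_cont_diff_on k S f" using assms by (cases r) auto
  show ?thesis
  proof (cases k)
    case 0
    with k show ?thesis by simp
  next
    case (Suc l)
    with k have "\<forall>x\<in>S. f differentiable (at x)" by simp
    then show ?thesis
      using continuous_at_imp_continuous_on differentiable_imp_continuous_within by blast
  qed
qed

lemma open_chart_image:
  assumes man: "manifold s A" and c: "c \<in> A" and W: "openin (atlas_topology A) W"
  shows "open (cmap c ` (W \<inter> cdom c))"
proof -
  have inj: "inj_on (cmap c) (cdom c)"
    using man c by (auto simp: manifold_def)
  have "generate_topology_on {{q \<in> cdom c. cmap c q \<in> B} | c B. c \<in> A \<and> open B} W"
    using W unfolding atlas_topology_def openin_topology_generated_by_iff .
  then show ?thesis
  proof induction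
    case Empty
    then show ?case by simp
  next
    case (Int a b)
    have "cmap c ` (a \<inter> b \<inter> cdom c) = cmap c ` (a \<inter> cdom c) \<inter> cmap c ` (b \<inter> cdom c)"
      using inj by (auto simp: inj_on_def)
    then show ?case using Int by auto
  next
    case (UN K)
    have "cmap c ` (\<Union> K \<inter> cdom c) = (\<Union>k\<in>K. cmap c ` (k \<inter> cdom c))" by auto
    then show ?case using UN by auto
  next
    case (Basis S)
    then obtain d B where d: "d \<in> A" and B: "open B" and S: "S = {q \<in> cdom d. cmap d q \<in> B}"
      by auto
    let ?U = "cmap c ` (cdom c \<inter> cdom d)"
    have oU: "open ?U" using man c d by (auto simp: manifold_def)
    have r: "Cr_on s ?U (cmap d \<circ> cinv c)" using man c d by (auto simp: manifold_def)
    have cont: "continuous_on ?U (cmap d \<circ> cinv c)"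
      by (rule Cr_on_continuous[OF r])
    have "cmap c ` (S \<inter> cdom c) = ?U \<inter> (cmap d \<circ> cinv c) -` B"
      using inj by (auto simp: S)
    then show ?case
      using continuous_open_preimage[OF cont oU B] by simp
  qed
qed

lemma openin_cdom:
  assumes "c \<in> A"
  shows "openin (atlas_topology A) (cdom c)"
proof -
  have "cdom c = {q \<in> cdom c. cmap c q \<in> UNIV}" by simp
  then have "cdom c \<in> {{q \<in> cdom c. cmap c q \<in> B} | c B. c \<in> A \<and> open B}"
    using assms open_UNIV by blast
  then show ?thesis unfolding atlas_topology_def by (rule topology_generated_by_Basis)
qed

lemma open_preimage_chart_image:
  assumes man: "manifold s A" and g: "Cr_map r A B g" and c: "c \<in> A" and d: "d \<in> B"
  shows "open (cmap c ` {q \<in> cdom c. g q \<in> cdom d})"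
proof -
  let ?W = "{q \<in> topspace (atlas_topology A). g q \<in> cdom d}"
  have "openin (atlas_topology A) ?W"
    using g openin_continuous_map_preimage[OF _ openin_cdom[OF d]] unfolding Cr_map_def by blast
  from open_chart_image[OF man c this] have "open (cmap c ` (?W \<inter> cdom c))" .
  moreover have "?W \<inter> cdom c = {q \<in> cdom c. g q \<in> cdom d}"
    using openin_subset[OF openin_cdom[OF c]] by blast
  ultimately show ?thesis by simp
qed

lemma Cr_on_differentiable:
  assumes "Cr_on r S f" "r \<noteq> C_fin 0" "x \<in> S"
  shows "f differentiable (at x)"
proof -
  obtain k where k: "k_times_cont_diff_on (Suc k) S f"
  proof (cases r)
    case (C_fin l)
    with assms(2) obtain k where "l = Suc k" using not0_implies_Suc by blast
    with C_fin assms(1) have "k_times_cont_diff_on (Suc k) S f" by (simp only: Cr_on.simps)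
    with that show ?thesis .
  next
    case C_infinity
    have "\<forall>k. k_times_cont_diff_on k S f"
      using assms(1) unfolding C_infinity Cr_on.simps .
    then have "k_times_cont_diff_on (Suc 0) S f" ..
    with that show ?thesis .
  next
    case C_omega
    have "\<forall>k. k_times_cont_diff_on k S f"
      using assms(1) unfolding C_omega Cr_on.simps by (rule conjunct1)
    then have "k_times_cont_diff_on (Suc 0) S f" ..
    with that show ?thesis .
  qed
  then show ?thesis using assms(3) by simp
qed

lemma Cr_map_differentiable:
  assumes "Cr_map r A B g" "r \<noteq> C_fin 0" "c \<in> A" "d \<in> B" "q \<in> cdom c" "g q \<in> cdom d"
  shows "(cmap d \<circ> g \<circ> cinv c) differentiable (at (cmap c q))"
  using assms by (intro Cr_on_differentiable[of r "cmap c ` {q \<in> cdom c. g q \<in> cdom d}"])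
    (auto simp: Cr_map_def)

lemma jacobian_compose:
  fixes c :: "('a, real^'n::finite) chart" and d :: "('c, real^'n) chart"
    and e :: "('b, real^'n) chart"
  assumes inj: "inj_on (cmap c) (cdom c)" "inj_on (cmap d) (cdom d)"
    and c: "q \<in> cdom c" "g q \<in> cdom d"
    and op: "open (cmap c ` {q \<in> cdom c. g q \<in> cdom d})"
    and L1: "(cmap d \<circ> g \<circ> cinv c) differentiable (at (cmap c q))"
    and L2: "(cmap e \<circ> h \<circ> cinv d) differentiable (at (cmap d (g q)))"
  shows "chart_jacobian (h \<circ> g) c e q = chart_jacobian h d e (g q) ** chart_jacobian g c d q"
proof -
  let ?x = "cmap c q" and ?f = "cmap d \<circ> g \<circ> cinv c" and ?h = "cmap e \<circ> h \<circ> cinv d"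
  let ?U = "cmap c ` {q \<in> cdom c. g q \<in> cdom d}"
  have fx: "?f ?x = cmap d (g q)" using inj c by simp
  have D1: "(?f has_derivative frechet_derivative ?f (at ?x)) (at ?x)"
    using L1 frechet_derivative_works by blast
  have D2: "(?h has_derivative frechet_derivative ?h (at (?f ?x))) (at (?f ?x))"
    using L2 frechet_derivative_works unfolding fx by blast
  have D: "((?h \<circ> ?f) has_derivative
      (frechet_derivative ?h (at (?f ?x)) \<circ> frechet_derivative ?f (at ?x))) (at ?x)"
    by (rule diff_chain_at[OF D1 D2])
  have "((cmap e \<circ> (h \<circ> g) \<circ> cinv c) has_derivative
      (frechet_derivative ?h (at (?f ?x)) \<circ> frechet_derivative ?f (at ?x))) (at ?x)"
    by (rule has_derivative_transform_within_open[OF D op]) (use inj c in auto)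
  then have "frechet_derivative (cmap e \<circ> (h \<circ> g) \<circ> cinv c) (at ?x) =
      frechet_derivative ?h (at (?f ?x)) \<circ> frechet_derivative ?f (at ?x)"
    using frechet_derivative_at by metis
  then show ?thesis
    unfolding chart_jacobian_def fx[symmetric]
    using matrix_compose[OF has_derivative_linear[OF D1] has_derivative_linear[OF D2]] by simp
qed

lemma jacobian_cong:
  fixes c :: "('a, real^'n::finite) chart"
  assumes "open (cmap c ` cdom c)" "inj_on (cmap c) (cdom c)" "q \<in> cdom c"
    and "\<And>q'. q' \<in> cdom c \<Longrightarrow> g q' = h q'"
  shows "chart_jacobian g c d q = chart_jacobian h c d q"
proof -
  have tr: "((cmap d \<circ> h' \<circ> cinv c) has_derivative D) (at (cmap c q))"
    if "((cmap d \<circ> g' \<circ> cinv c) has_derivative D) (at (cmap c q))"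
      and eq: "\<And>q'. q' \<in> cdom c \<Longrightarrow> g' q' = h' q'" for g' h' D
    by (rule has_derivative_transform_within_open[OF that(1) assms(1)])
      (use assms(2,3) eq in auto)
  have "((cmap d \<circ> g \<circ> cinv c) has_derivative D) (at (cmap c q)) \<longleftrightarrow>
        ((cmap d \<circ> h \<circ> cinv c) has_derivative D) (at (cmap c q))" for D
    using tr[of g D h] tr[of h D g] assms(4) by metis
  then show ?thesis by (simp add: chart_jacobian_def frechet_derivative_def)
qed

lemma jacobian_id:
  fixes c :: "('a, real^'n::finite) chart"
  assumes "open (cmap c ` cdom c)" "inj_on (cmap c) (cdom c)" "q \<in> cdom c"
  shows "chart_jacobian id c c q = mat 1"
proof -
  have "((cmap c \<circ> id \<circ> cinv c) has_derivative id) (at (cmap c q))"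
    by (rule has_derivative_transform_within_open[OF has_derivative_id assms(1)])
      (use assms in auto)
  then have "frechet_derivative (cmap c \<circ> id \<circ> cinv c) (at (cmap c q)) = id"
    using frechet_derivative_at by metis
  then show ?thesis unfolding chart_jacobian_def by (simp only: matrix_id_mat_1)
qed

lemma jacobian_invertible:
  fixes A :: "('a, real^'n::finite) chart set"
  assumes r: "r \<noteq> C_fin 0" and man: "manifold s A" and f: "diffeomorphism r A A f"
    and c: "c \<in> A" "q \<in> cdom c" and d: "d \<in> A" "f q \<in> cdom d"
  shows "invertible (chart_jacobian f c d q)"
proof -
  let ?g = "inv_into (underlying_set A) f"
  have bij: "bij_betw f (underlying_set A) (underlying_set A)" and fm: "Cr_map r A A f" and gm: "Cr_map r A A ?g"
    using f by (auto simp: diffeomorphism_def)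
  have qc: "q \<in> underlying_set A" using c by (auto simp: underlying_set_def)
  have gf: "?g (f q') = q'" if "q' \<in> underlying_set A" for q'
    using bij that by (simp add: bij_betw_inv_into_left)
  have inj: "inj_on (cmap c) (cdom c)" "inj_on (cmap d) (cdom d)"
    and op: "open (cmap c ` cdom c)"
    using man c d by (auto simp: manifold_def)
  have op2: "open (cmap c ` {q \<in> cdom c. f q \<in> cdom d})"
    by (rule open_preimage_chart_image[OF man fm c(1) d(1)])
  have "chart_jacobian (?g \<circ> f) c c q = chart_jacobian ?g d c (f q) ** chart_jacobian f c d q"
  proof (rule jacobian_compose[OF inj c(2) d(2) op2])
    show "cmap d \<circ> f \<circ> cinv c differentiable at (cmap c q)"
      by (rule Cr_map_differentiable[OF fm r c(1) d(1) c(2) d(2)])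
    show "cmap c \<circ> ?g \<circ> cinv d differentiable at (cmap d (f q))"
      by (rule Cr_map_differentiable[OF gm r d(1) c(1) d(2)]) (use gf[OF qc] c in simp)
  qed
  moreover have "chart_jacobian (?g \<circ> f) c c q = chart_jacobian id c c q"
    by (rule jacobian_cong[OF op inj(1) c(2)]) (use gf c in \<open>auto simp: underlying_set_def\<close>)
  ultimately have "chart_jacobian ?g d c (f q) ** chart_jacobian f c d q = mat 1"
    using jacobian_id[OF op inj(1) c(2)] by simp
  then show ?thesis
    using invertible_left_inverse by blast
qed

theorem cotangent_lift_coords:
  fixes A :: "('a, real^'n::finite) chart set"
  assumes r: "r \<noteq> C_fin 0" and man: "manifold s A" and s: "s \<noteq> C_fin 0"
    and f: "diffeomorphism r A A f"
    and y: "(q, p) \<in> cotangent_bundle A"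
    and c: "c \<in> A" "q \<in> cdom c" and d: "d \<in> A" "f q \<in> cdom d"
  shows "p c = transpose (chart_jacobian f c d q) *v snd (cotangent_lift A f (q, p)) d"
proof -
  define c0 where "c0 = (SOME c. c \<in> A \<and> q \<in> cdom c)"
  have c0: "c0 \<in> A" "q \<in> cdom c0"
    using someI[of "\<lambda>c. c \<in> A \<and> q \<in> cdom c" c] c unfolding c0_def by auto
  let ?J = "chart_jacobian f c0 d q" and ?T = "chart_jacobian id c c0 q"
  have fm: "Cr_map r A A f" using f by (simp add: diffeomorphism_def)
  have inj: "inj_on (cmap c) (cdom c)" "inj_on (cmap c0) (cdom c0)"
    using man c c0 by (auto simp: manifold_def)
  have op: "open (cmap c ` (cdom c \<inter> cdom c0))"
    and tr: "Cr_on s (cmap c ` (cdom c \<inter> cdom c0)) (cmap c0 \<circ> cinv c)"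
    using man c c0 by (auto simp: manifold_def)
  have op': "open (cmap c ` {q \<in> cdom c. id q \<in> cdom c0})"
    using op by (simp add: Int_def)
  have "chart_jacobian (f \<circ> id) c d q = chart_jacobian f c0 d (id q) ** ?T"
  proof (rule jacobian_compose[OF inj c(2) _ op'])
    show "id q \<in> cdom c0" using c0 by simp
    show "cmap c0 \<circ> id \<circ> cinv c differentiable at (cmap c q)"
      using Cr_on_differentiable[OF tr s] c c0 by auto
    show "cmap d \<circ> f \<circ> cinv c0 differentiable at (cmap c0 (id q))"
      using Cr_map_differentiable[OF fm r c0(1) d(1)] c0 d by simp
  qed
  then have J: "chart_jacobian f c d q = ?J ** ?T" by simp
  have "invertible ?J"
    by (rule jacobian_invertible[OF r man f c0 d])
  then have "invertible (transpose ?J)" by (rule transpose_invertible)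
  then have inv: "transpose ?J ** matrix_inv (transpose ?J) = mat 1"
    unfolding matrix_inv_def invertible_def by (rule someI_ex[THEN conjunct1])
  have lift: "snd (cotangent_lift A f (q, p)) d = matrix_inv (transpose ?J) *v p c0"
    using d by (simp add: cotangent_lift_def c0_def Let_def)
  have "transpose (chart_jacobian f c d q) *v snd (cotangent_lift A f (q, p)) d =
      transpose ?T *v ((transpose ?J ** matrix_inv (transpose ?J)) *v p c0)"
    unfolding J lift by (simp add: matrix_transpose_mul matrix_vector_mul_assoc matrix_mul_assoc)
  also have "\<dots> = transpose ?T *v p c0" by (simp add: inv)
  also have "\<dots> = p c"
  proof -
    have "\<forall>c\<in>A. \<forall>d\<in>A. q \<in> cdom c \<inter> cdom d \<longrightarrow>
        p c = transpose (chart_jacobian id c d q) *v p d"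
      using y unfolding cotangent_bundle_def by blast
    with c c0 have "p c = transpose ?T *v p c0" by blast
    then show ?thesis by (rule sym)
  qed
  finally show ?thesis by (rule sym)
qed

theorem cotangent_lift_in_bundle:
  fixes A :: "('a, real^'n::finite) chart set"
  assumes r: "r \<noteq> C_fin 0" and man: "manifold s A" and s: "s \<noteq> C_fin 0"
    and f: "diffeomorphism r A A f"
    and y: "(q, p) \<in> cotangent_bundle A"
  shows "cotangent_lift A f (q, p) \<in> cotangent_bundle A"
proof -
  define P where "P = snd (cotangent_lift A f (q, p))"
  have lift: "cotangent_lift A f (q, p) = (f q, P)"
    by (simp add: P_def cotangent_lift_def)
  have q: "q \<in> underlying_set A" using y by (simp add: cotangent_bundle_def)
  then obtain c where c: "c \<in> A" "q \<in> cdom c" by (auto simp: underlying_set_def)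
  have fm: "Cr_map r A A f" and bij: "bij_betw f (underlying_set A) (underlying_set A)"
    using f by (auto simp: diffeomorphism_def)
  have fq: "f q \<in> underlying_set A" using bij q by (rule bij_betwE[THEN bspec])
  have out: "P d = 0" if "\<not> (d \<in> A \<and> f q \<in> cdom d)" for d
    using that by (auto simp: P_def cotangent_lift_def)
  have compat: "P d = transpose (chart_jacobian id d e (f q)) *v P e"
    if d: "d \<in> A" "f q \<in> cdom d" and e: "e \<in> A" "f q \<in> cdom e" for d e
  proof -
    let ?J = "chart_jacobian f c d q" and ?T = "chart_jacobian id d e (f q)"
    have inj: "inj_on (cmap c) (cdom c)" "inj_on (cmap d) (cdom d)"
      using man c d by (auto simp: manifold_def)
    have tr: "Cr_on s (cmap d ` (cdom d \<inter> cdom e)) (cmap e \<circ> cinv d)"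
      using man d e by (auto simp: manifold_def)
    have "chart_jacobian (id \<circ> f) c e q = ?T ** ?J"
    proof (rule jacobian_compose[where g = f, OF inj c(2) d(2)])
      show "open (cmap c ` {q \<in> cdom c. f q \<in> cdom d})"
        by (rule open_preimage_chart_image[OF man fm c(1) d(1)])
      show "cmap d \<circ> f \<circ> cinv c differentiable at (cmap c q)"
        by (rule Cr_map_differentiable[OF fm r c(1) d(1) c(2) d(2)])
      show "cmap e \<circ> id \<circ> cinv d differentiable at (cmap d (f q))"
        using Cr_on_differentiable[OF tr s] d e by auto
    qed
    then have J: "chart_jacobian f c e q = ?T ** ?J" by simp
    have "transpose ?J *v P d = transpose (chart_jacobian f c e q) *v P e"
      using cotangent_lift_coords[OF r man s f y c d] cotangent_lift_coords[OF r man s f y c e]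
      unfolding P_def by (rule trans[OF sym])
    also have "\<dots> = transpose ?J *v (transpose ?T *v P e)"
      unfolding J by (simp only: matrix_transpose_mul matrix_vector_mul_assoc)
    finally have *: "transpose ?J *v P d = transpose ?J *v (transpose ?T *v P e)" .
    have "invertible (transpose ?J)"
      by (rule transpose_invertible[OF jacobian_invertible[OF r man f c d]])
    then obtain B where "B ** transpose ?J = mat 1" unfolding invertible_def by blast
    with arg_cong[OF *, of "(*v) B"] show ?thesis
      by (simp only: matrix_vector_mul_assoc[of B] matrix_vector_mul_lid)
  qed
  show ?thesis
    unfolding lift cotangent_bundle_def using fq out compat by blast
qed

end

theory Submission
  imports Defs
begin

text \<open>
  The integrals of the lift are the momenta \<open>\<langle>p, X\<^sub>j(q)\<rangle>\<close> and the functions \<open>F\<^sub>k(q)\<close>. Differentiating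
  \<open>f \<circ> \<phi>\<^sup>t = \<phi>\<^sup>t \<circ> f\<close> at \<open>t = 0\<close> shows that \<open>X\<^sub>j\<close> is \<open>f\<close>-invariant, hence its momentum is invariant under
  the lift. The Poisson bracket of two momenta is \<open>-\<langle>p, [X\<^sub>i, X\<^sub>j]\<rangle>\<close>, that of a momentum and \<open>F\<^sub>k\<close> is
  \<open>-dF\<^sub>k(X\<^sub>j)\<close>. The gradients \<open>(\<dots>, X\<^sub>j)\<close> and \<open>(dF\<^sub>k, 0)\<close> form a block triangular family. The inverse
  of the lift is the lift of the inverse.
\<close>

subsection \<open>Calculus of \<open>C\<^sup>k\<close> maps\<close>

text \<open>Two regularities have to be kept apart. The lift contains \<open>Df\<close> and loses
  one derivative, whereas its integrals must keep class \<open>r\<close>. They do, because they are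
  built from base data alone: \<open>F\<^sub>k(q)\<close> is constant along fibres, and a momentum
  is linear in \<open>p\<close> with the components of \<open>X\<^sub>j\<close> as coefficients. In
  the analytic class it therefore suffices that power series survive pullback along the projection,
  bounded linear maps, sums and multiplication by a coordinate; general products, compositions and
  inverses of series never arise.

  The Jacobian of \<open>f\<close> enters mostly through an identity between covectors: in any
  charts the old covector is the transposed Jacobian applied to the new one. Pairing this with
  vectors yields the invariance of momenta, the inverse of the lift and its symplecticity.

  Independence almost everywhere carries over because the \<open>p\<close>-part of a momentum
  gradient is \<open>X\<^sub>j\<close> itself, which does not involve \<open>p\<close>: a good base
  point is good for every covector above it, and the bad covectors lie over a null set of the
  base.\<close>

lemma k_times_cont_diff_on_cong:
  assumes "open S" "k_times_cont_diff_on k S f" "\<And>x. x \<in> S \<Longrightarrow> f x = g x"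
  shows "k_times_cont_diff_on k S g"
  using assms(2,3)
proof (induction k arbitrary: f g)
  case 0
  then show ?case using continuous_on_cong[of S S f g] by simp
next
  case (Suc k)
  have diff: "f differentiable (at x)" if "x \<in> S" for x
    using Suc.prems(1) that by simp
  have "g differentiable (at x)" if "x \<in> S" for x
    using diff[OF that] that Suc.prems(2) \<open>open S\<close> unfolding differentiable_def
    by (meson has_derivative_transform_within_open)
  moreover have "k_times_cont_diff_on k S (\<lambda>x. frechet_derivative g (at x) v)" for v
  proof (rule Suc.IH)
    show "k_times_cont_diff_on k S (\<lambda>x. frechet_derivative f (at x) v)"
      using Suc.prems(1) by simp
    show "frechet_derivative f (at x) v = frechet_derivative g (at x) v" if "x \<in> S" for x
      using frechet_derivative_transform_within_open[OF diff[OF that] \<open>open S\<close> that] Suc.prems(2)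
      by simp
  qed
  ultimately show ?case by simp
qed

lemma k_times_cont_diff_on_SucD:
  "k_times_cont_diff_on (Suc k) S f \<Longrightarrow> k_times_cont_diff_on k S f"
proof (induction k arbitrary: f)
  case 0
  then have "\<forall>x\<in>S. f differentiable (at x)" by simp
  then have "continuous_on S f"
    using continuous_at_imp_continuous_on differentiable_imp_continuous_within by blast
  then show ?case by simp
next
  case (Suc k)
  have "k_times_cont_diff_on k S (\<lambda>x. frechet_derivative f (at x) v)" for v
    by (rule Suc.IH) (use Suc.prems in simp)
  moreover have "\<forall>x\<in>S. f differentiable (at x)" using Suc.prems by simp
  ultimately show ?case by simp
qed

lemma k_times_cont_diff_on_mono:
  assumes "k_times_cont_diff_on k S f" "l \<le> k"
  shows "k_times_cont_diff_on l S f"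
  using assms(2,1)
  by (induction rule: dec_induct) (blast dest: k_times_cont_diff_on_SucD)+

lemma k_times_cont_diff_on_subset:
  "k_times_cont_diff_on k S f \<Longrightarrow> T \<subseteq> S \<Longrightarrow> k_times_cont_diff_on k T f"
proof (induction k arbitrary: f)
  case 0
  then show ?case using continuous_on_subset by simp
next
  case (Suc k)
  then show ?case by (simp add: subset_iff)
qed

text \<open>The closure proofs obtain a derivative \<open>f'\<close> from a differentiation rule;
  uniqueness of derivatives identifies it with \<open>frechet_derivative\<close> on
  \<open>S\<close>, so that the inductions can work with the explicit formula.\<close>

lemma k_times_cont_diff_on_SucI:
  assumes "open S"
    and "\<And>x. x \<in> S \<Longrightarrow> (f has_derivative f' x) (at x)"
    and "\<And>v. k_times_cont_diff_on k S (\<lambda>x. f' x v)"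
  shows "k_times_cont_diff_on (Suc k) S f"
proof -
  have "f' x = frechet_derivative f (at x)" if "x \<in> S" for x
    using assms(2)[OF that] by (rule frechet_derivative_at)
  then have "k_times_cont_diff_on k S (\<lambda>x. frechet_derivative f (at x) v)" for v
    by (intro k_times_cont_diff_on_cong[OF assms(1) assms(3)[of v]]) simp
  then show ?thesis using assms(2) by (auto simp: differentiable_def)
qed

lemma k_times_cont_diff_on_SucE:
  assumes "k_times_cont_diff_on (Suc k) S f" "x \<in> S"
  shows "(f has_derivative frechet_derivative f (at x)) (at x)"
  using assms frechet_derivative_works by auto

lemma k_times_cont_diff_on_const: "k_times_cont_diff_on k S (\<lambda>x. c)"
  by (induction k arbitrary: c) auto

lemma k_times_cont_diff_on_linear:
  assumes "bounded_linear L"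
  shows "k_times_cont_diff_on k S L"
proof (cases k)
  case 0
  then show ?thesis by (simp add: assms linear_continuous_on)
next
  case (Suc l)
  have D: "(L has_derivative L) (at x)" for x
    by (rule bounded_linear_imp_has_derivative[OF assms])
  then have "frechet_derivative L (at x) = L" for x
    using frechet_derivative_at by metis
  then show ?thesis using Suc D by (auto simp: k_times_cont_diff_on_const differentiable_def)
qed

lemma k_times_cont_diff_on_linear_comp:
  assumes L: "bounded_linear L" and "open S" and "k_times_cont_diff_on k S f"
  shows "k_times_cont_diff_on k S (\<lambda>x. L (f x))"
  using assms(3)
proof (induction k arbitrary: f)
  case 0
  then show ?case
    by (simp add: bounded_linear.continuous_on[OF L])
next
  case (Suc k)
  show ?case
  proof (rule k_times_cont_diff_on_SucI[OF \<open>open S\<close>])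
    show "((\<lambda>x. L (f x)) has_derivative (\<lambda>v. L (frechet_derivative f (at x) v))) (at x)"
      if "x \<in> S" for x
      by (rule bounded_linear.has_derivative[OF L k_times_cont_diff_on_SucE[OF Suc.prems that]])
  qed (use Suc in auto)
qed

lemma k_times_cont_diff_on_add:
  assumes "open S" and "k_times_cont_diff_on k S f" "k_times_cont_diff_on k S g"
  shows "k_times_cont_diff_on k S (\<lambda>x. f x + g x)"
  using assms(2,3)
proof (induction k arbitrary: f g)
  case 0
  then show ?case by (simp add: continuous_on_add)
next
  case (Suc k)
  show ?case
  proof (rule k_times_cont_diff_on_SucI[OF \<open>open S\<close>])
    show "((\<lambda>x. f x + g x) has_derivative
        (\<lambda>v. frechet_derivative f (at x) v + frechet_derivative g (at x) v)) (at x)"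
      if "x \<in> S" for x
      using Suc.prems that by (intro has_derivative_add k_times_cont_diff_on_SucE)
  qed (use Suc in auto)
qed

lemma k_times_cont_diff_on_sum:
  assumes "open S" and "\<And>i. i \<in> I \<Longrightarrow> k_times_cont_diff_on k S (f i)"
  shows "k_times_cont_diff_on k S (\<lambda>x. \<Sum>i\<in>I. f i x)"
  using assms(2)
  by (induction I rule: infinite_finite_induct)
    (auto simp: k_times_cont_diff_on_const intro!: k_times_cont_diff_on_add[OF assms(1)])

lemma k_times_cont_diff_on_bilinear:
  assumes B: "bounded_bilinear B" and "open S"
    and "k_times_cont_diff_on k S f" "k_times_cont_diff_on k S g"
  shows "k_times_cont_diff_on k S (\<lambda>x. B (f x) (g x))"
  using assms(3,4)
proof (induction k arbitrary: f g)
  case 0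
  then show ?case by (simp add: bounded_bilinear.continuous_on[OF B])
next
  case (Suc k)
  show ?case
  proof (rule k_times_cont_diff_on_SucI[OF \<open>open S\<close>])
    show "((\<lambda>x. B (f x) (g x)) has_derivative
        (\<lambda>v. B (f x) (frechet_derivative g (at x) v) + B (frechet_derivative f (at x) v) (g x)))
        (at x)"
      if "x \<in> S" for x
      using Suc.prems that
      by (intro bounded_bilinear.FDERIV[OF B] k_times_cont_diff_on_SucE)
    \<comment> \<open>Each product contains one undifferentiated factor, which is lowered from order
      \<open>Suc k\<close> to order \<open>k\<close> so that the induction hypothesis covers
      it.\<close>
    show "k_times_cont_diff_on k S
        (\<lambda>x. B (f x) (frechet_derivative g (at x) v) + B (frechet_derivative f (at x) v) (g x))"
      for v
      using Suc.prems Suc.prems[THEN k_times_cont_diff_on_SucD]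
      by (intro k_times_cont_diff_on_add[OF \<open>open S\<close>] Suc.IH) simp_all
  qed
qed

text \<open>The class \<open>C^k\<close> is defined through derivatives in a fixed direction, but in
  the chain rule the direction fed to the outer derivative moves with the point. Expanding it in the
  basis leaves fixed directions with variable scalar coefficients.\<close>

lemma frechet_derivative_Basis_expansion:
  fixes h :: "'e::euclidean_space \<Rightarrow> 'f::real_normed_vector"
  assumes "h differentiable (at x)"
  shows "frechet_derivative h (at x) v = (\<Sum>b\<in>Basis. (v \<bullet> b) *\<^sub>R frechet_derivative h (at x) b)"
proof -
  have lin: "linear (frechet_derivative h (at x))"
    by (rule linear_frechet_derivative[OF assms])
  have "frechet_derivative h (at x) (\<Sum>b\<in>Basis. (v \<bullet> b) *\<^sub>R b) =
      (\<Sum>b\<in>Basis. (v \<bullet> b) *\<^sub>R frechet_derivative h (at x) b)"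
    by (simp add: linear_sum[OF lin] linear_cmul[OF lin])
  then show ?thesis by (simp add: euclidean_representation)
qed

lemma k_times_cont_diff_on_comp:
  fixes f :: "'e::euclidean_space \<Rightarrow> 'f::euclidean_space"
    and h :: "'f \<Rightarrow> 'g::real_normed_vector"
  assumes S: "open S" and "k_times_cont_diff_on k T h" "k_times_cont_diff_on k S f" "f ` S \<subseteq> T"
  shows "k_times_cont_diff_on k S (\<lambda>x. h (f x))"
  using assms(2-)
proof (induction k arbitrary: f h)
  case 0
  then show ?case by (auto intro: continuous_on_compose2)
next
  case (Suc k)
  let ?Df = "\<lambda>x. frechet_derivative f (at x)" and ?Dh = "\<lambda>x. frechet_derivative h (at x)"
  have hd: "h differentiable (at (f x))" if "x \<in> S" for x
    using Suc.prems that by auto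
  show ?case
  proof (rule k_times_cont_diff_on_SucI[OF S])
    fix x assume x: "x \<in> S"
    have "f x \<in> T" using x Suc.prems by auto
    then have "((\<lambda>x. h (f x)) has_derivative (\<lambda>v. ?Dh (f x) (?Df x v))) (at x)"
      by (intro has_derivative_compose[OF k_times_cont_diff_on_SucE[OF Suc.prems(2) x]]
          k_times_cont_diff_on_SucE[OF Suc.prems(1)])
    also have "(\<lambda>v. ?Dh (f x) (?Df x v)) = (\<lambda>v. \<Sum>b\<in>Basis. (?Df x v \<bullet> b) *\<^sub>R ?Dh (f x) b)"
      by (rule ext, rule frechet_derivative_Basis_expansion[OF hd[OF x]])
    finally show "((\<lambda>x. h (f x)) has_derivative
        (\<lambda>v. \<Sum>b\<in>Basis. (?Df x v \<bullet> b) *\<^sub>R ?Dh (f x) b)) (at x)" .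
  next
    fix v
    \<comment> \<open>The outer map is replaced by its directional derivative
      \<open>\<lambda>y. ?Dh y b\<close>, which is why the induction generalises over
      \<open>h\<close>.\<close>
    have *: "k_times_cont_diff_on k S (\<lambda>x. ?Dh (f x) b)" for b
      using Suc.prems k_times_cont_diff_on_SucD[OF Suc.prems(2)]
      by (intro Suc.IH[of "\<lambda>y. ?Dh y b"]) simp_all
    show "k_times_cont_diff_on k S (\<lambda>x. \<Sum>b\<in>Basis. (?Df x v \<bullet> b) *\<^sub>R ?Dh (f x) b)"
      using Suc.prems(2)
      by (intro k_times_cont_diff_on_sum[OF S] *
          k_times_cont_diff_on_bilinear[OF bounded_bilinear_scaleR S]
          k_times_cont_diff_on_linear_comp[OF bounded_linear_inner_left S]) simp_all
  qed
qed

lemma k_times_cont_diff_on_Pair: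
  assumes "open S" "k_times_cont_diff_on k S f" "k_times_cont_diff_on k S g"
  shows "k_times_cont_diff_on k S (\<lambda>x. (f x, g x))"
proof -
  have "k_times_cont_diff_on k S (\<lambda>x. (f x, 0) + (0, g x))"
    using assms
    by (intro k_times_cont_diff_on_add k_times_cont_diff_on_linear_comp[of "\<lambda>x. (x, 0)"]
        k_times_cont_diff_on_linear_comp[of "\<lambda>x. (0, x)"] bounded_linear_Pair
        bounded_linear_ident bounded_linear_zero)
  then show ?thesis by simp
qed

lemma k_times_cont_diff_on_fst:
  fixes f :: "'e::euclidean_space \<Rightarrow> 'g::real_normed_vector"
  assumes "open S" "k_times_cont_diff_on k S f"
  shows "k_times_cont_diff_on k (S \<times> (UNIV :: 'f::euclidean_space set)) (\<lambda>z. f (fst z))"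
proof (rule k_times_cont_diff_on_comp[OF _ assms(2)])
  show "k_times_cont_diff_on k (S \<times> (UNIV :: 'f set)) fst"
    by (rule k_times_cont_diff_on_linear[OF bounded_linear_fst])
qed (use assms(1) in \<open>auto simp: open_Times\<close>)

text \<open>By the mean value theorem, applied twice in either order, the second difference over a small parallelogram is a value of either mixed derivative.\<close>

lemma second_difference_mean_value:
  fixes f :: "'e::euclidean_space \<Rightarrow> real"
  assumes f: "k_times_cont_diff_on 2 (ball x d) f" and h: "0 < h" "h * (norm v + norm w) < d"
  shows "\<exists>z. norm (z - x) \<le> h * (norm v + norm w) \<and>
    f (x + h *\<^sub>R v + h *\<^sub>R w) - f (x + h *\<^sub>R v) - f (x + h *\<^sub>R w) + f x =
    h * h * frechet_derivative (\<lambda>y. frechet_derivative f (at y) v) (at z) w"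
proof -
  let ?Dv = "\<lambda>y. frechet_derivative f (at y) v"
  have f1: "(f has_derivative frechet_derivative f (at y)) (at y)" if "y \<in> ball x d" for y
    by (rule k_times_cont_diff_on_SucE[OF f[unfolded numeral_2_eq_2] that])
  have f2: "(?Dv has_derivative frechet_derivative ?Dv (at y)) (at y)" if "y \<in> ball x d" for y
    by (rule k_times_cont_diff_on_SucE[of 0, OF _ that]) (use f in \<open>simp add: numeral_2_eq_2\<close>)
  have near: "norm ((x + s *\<^sub>R v + t *\<^sub>R w) - x) \<le> h * (norm v + norm w)"
    if "0 \<le> s" "s \<le> h" "0 \<le> t" "t \<le> h" for s t
  proof -
    have "norm (s *\<^sub>R v + t *\<^sub>R w) \<le> s * norm v + t * norm w"
      using norm_triangle_ineq[of "s *\<^sub>R v" "t *\<^sub>R w"] that by simp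
    also have "\<dots> \<le> h * norm v + h * norm w"
      using that by (intro add_mono mult_right_mono) auto
    finally show ?thesis by (simp add: algebra_simps)
  qed
  have inb: "x + s *\<^sub>R v + t *\<^sub>R w \<in> ball x d"
    if "0 \<le> s" "s \<le> h" "0 \<le> t" "t \<le> h" for s t
    using le_less_trans[OF near[OF that] h(2)] by (simp only: mem_ball dist_norm norm_minus_commute)
  \<comment> \<open>The summand \<open>0 *\<^sub>R w\<close> makes both terms instances of
    \<open>D1\<close>, with \<open>t = h\<close> and \<open>t = 0\<close>, and prepares the
    endpoints of the second mean value step.\<close>
  let ?a = "\<lambda>s. f (x + s *\<^sub>R v + h *\<^sub>R w) - f (x + s *\<^sub>R v + 0 *\<^sub>R w)"
  have D1: "((\<lambda>s. f (x + s *\<^sub>R v + t *\<^sub>R w)) has_real_derivative ?Dv (x + s *\<^sub>R v + t *\<^sub>R w)) (at s)"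
    if "0 \<le> s" "s \<le> h" "0 \<le> t" "t \<le> h" for s t
  proof -
    have "((\<lambda>s. f (x + s *\<^sub>R v + t *\<^sub>R w)) has_derivative
        (\<lambda>r. frechet_derivative f (at (x + s *\<^sub>R v + t *\<^sub>R w)) (r *\<^sub>R v))) (at s)"
      by (rule has_derivative_compose[of "\<lambda>s. x + s *\<^sub>R v + t *\<^sub>R w" "\<lambda>r. r *\<^sub>R v",
            OF _ f1[OF inb[OF that]]])
        (auto intro!: derivative_eq_intros)
    then show ?thesis
      by (simp add: has_field_derivative_def linear_cmul[OF has_derivative_linear[OF f1[OF inb[OF that]]]]
          mult.commute[of _ "?Dv _"])
  qed
  have "\<exists>\<xi>>0. \<xi> < h \<and> ?a h - ?a 0 =
      (h - 0) * (?Dv (x + \<xi> *\<^sub>R v + h *\<^sub>R w) - ?Dv (x + \<xi> *\<^sub>R v + 0 *\<^sub>R w))"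
  proof (rule MVT2[OF \<open>0 < h\<close>])
    show "(?a has_real_derivative
        ?Dv (x + s *\<^sub>R v + h *\<^sub>R w) - ?Dv (x + s *\<^sub>R v + 0 *\<^sub>R w)) (at s)"
      if "0 \<le> s" "s \<le> h" for s
      by (rule DERIV_diff[OF D1 D1]) (use that h in auto)
  qed
  then obtain \<xi> where \<xi>: "0 < \<xi>" "\<xi> < h" and
    a: "?a h - ?a 0 = h * (?Dv (x + \<xi> *\<^sub>R v + h *\<^sub>R w) - ?Dv (x + \<xi> *\<^sub>R v + 0 *\<^sub>R w))" by auto
  have "\<exists>\<eta>>0. \<eta> < h \<and> ?Dv (x + \<xi> *\<^sub>R v + h *\<^sub>R w) - ?Dv (x + \<xi> *\<^sub>R v + 0 *\<^sub>R w) =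
      (h - 0) * frechet_derivative ?Dv (at (x + \<xi> *\<^sub>R v + \<eta> *\<^sub>R w)) w"
  proof (rule MVT2[OF \<open>0 < h\<close>])
    fix t assume t: "0 \<le> t" "t \<le> h"
    have i: "x + \<xi> *\<^sub>R v + t *\<^sub>R w \<in> ball x d"
      using \<xi> t by (intro inb) auto
    have "((\<lambda>t. ?Dv (x + \<xi> *\<^sub>R v + t *\<^sub>R w)) has_derivative
        (\<lambda>r. frechet_derivative ?Dv (at (x + \<xi> *\<^sub>R v + t *\<^sub>R w)) (r *\<^sub>R w))) (at t)"
      by (rule has_derivative_compose[of "\<lambda>t. x + \<xi> *\<^sub>R v + t *\<^sub>R w" "\<lambda>r. r *\<^sub>R w", OF _ f2[OF i]])
        (auto intro!: derivative_eq_intros)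
    then show "((\<lambda>t. ?Dv (x + \<xi> *\<^sub>R v + t *\<^sub>R w)) has_real_derivative
        frechet_derivative ?Dv (at (x + \<xi> *\<^sub>R v + t *\<^sub>R w)) w) (at t)"
      by (simp add: has_field_derivative_def linear_cmul[OF has_derivative_linear[OF f2[OF i]]]
          mult.commute[of _ "frechet_derivative ?Dv _ _"])
  qed
  then obtain \<eta> where \<eta>: "0 < \<eta>" "\<eta> < h"
    and b: "?Dv (x + \<xi> *\<^sub>R v + h *\<^sub>R w) - ?Dv (x + \<xi> *\<^sub>R v + 0 *\<^sub>R w) =
      h * frechet_derivative ?Dv (at (x + \<xi> *\<^sub>R v + \<eta> *\<^sub>R w)) w" by auto
  have "norm ((x + \<xi> *\<^sub>R v + \<eta> *\<^sub>R w) - x) \<le> h * (norm v + norm w)"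
    using \<xi> \<eta> by (intro near) auto
  moreover have "f (x + h *\<^sub>R v + h *\<^sub>R w) - f (x + h *\<^sub>R v) - f (x + h *\<^sub>R w) + f x =
      h * h * frechet_derivative ?Dv (at (x + \<xi> *\<^sub>R v + \<eta> *\<^sub>R w)) w"
    using a unfolding b by simp
  ultimately show ?thesis by blast
qed

text \<open>The second difference is symmetric in \<open>v\<close> and \<open>w\<close>, so the two
  mixed derivatives take a common value at points \<open>z\<close> and \<open>z'\<close> arbitrarily
  close to \<open>x\<close>; continuity of both carries the equality to \<open>x\<close>.\<close>

lemma second_derivative_symmetric:
  fixes f :: "'e::euclidean_space \<Rightarrow> real"
  assumes "open S" and f: "k_times_cont_diff_on 2 S f" and "x \<in> S"
  shows "frechet_derivative (\<lambda>y. frechet_derivative f (at y) v) (at x) w =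
    frechet_derivative (\<lambda>y. frechet_derivative f (at y) w) (at x) v" (is "?A x = ?B x")
proof (rule ccontr)
  assume ne: "?A x \<noteq> ?B x"
  \<comment> \<open>Half of the supposed gap: two errors below \<open>e\<close> cannot bridge
    it.\<close>
  define e where "e = \<bar>?A x - ?B x\<bar> / 2"
  have e: "e > 0" using ne by (simp add: e_def)
  obtain d0 where d0: "d0 > 0" "ball x d0 \<subseteq> S"
    using assms(1,3) by (meson open_contains_ball)
  have contA: "continuous_on S ?A" and contB: "continuous_on S ?B"
    using f by (simp_all add: numeral_2_eq_2)
  obtain dA where dA: "dA > 0" "\<And>y. y \<in> S \<Longrightarrow> dist y x < dA \<Longrightarrow> dist (?A y) (?A x) < e"
    using contA e \<open>x \<in> S\<close> unfolding continuous_on_iff by meson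
  obtain dB where dB: "dB > 0" "\<And>y. y \<in> S \<Longrightarrow> dist y x < dB \<Longrightarrow> dist (?B y) (?B x) < e"
    using contB e \<open>x \<in> S\<close> unfolding continuous_on_iff by meson
  define d where "d = Min {d0, dA, dB}"
  have d: "d > 0" "d \<le> d0" "d \<le> dA" "d \<le> dB" using d0 dA dB by (auto simp: d_def)
  \<comment> \<open>The summand 1 makes the parallelogram fit strictly inside the ball of radius
    \<open>d\<close> and keeps the denominator positive when \<open>v = w = 0\<close>.\<close>
  define h where "h = d / (norm v + norm w + 1)"
  have n0: "norm v + norm w + 1 > 0" by (simp add: add_nonneg_pos)
  have h0: "h > 0" using d n0 by (simp add: h_def)
  have "h * (norm v + norm w) < h * (norm v + norm w + 1)" using h0 by simp
  also have "\<dots> = d" using n0 by (simp add: h_def)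
  finally have h1: "h * (norm v + norm w) < d" .
  then have h2: "h * (norm w + norm v) < d" by (simp add: add.commute)
  have f': "k_times_cont_diff_on 2 (ball x d) f"
    using k_times_cont_diff_on_subset[OF f] d0 d by (meson order_trans subset_ball)
  obtain z where z: "norm (z - x) < d" and
    eqA: "f (x + h *\<^sub>R v + h *\<^sub>R w) - f (x + h *\<^sub>R v) - f (x + h *\<^sub>R w) + f x = h * h * ?A z"
    using second_difference_mean_value[OF f' h0 h1] h1 by (meson le_less_trans)
  obtain z' where z': "norm (z' - x) < d" and
    eqB: "f (x + h *\<^sub>R w + h *\<^sub>R v) - f (x + h *\<^sub>R w) - f (x + h *\<^sub>R v) + f x = h * h * ?B z'"
    using second_difference_mean_value[OF f' h0 h2] h2 by (meson le_less_trans)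
  have "h * h * ?A z = h * h * ?B z'"
    unfolding eqA[symmetric] eqB[symmetric] by (simp add: algebra_simps)
  then have "?A z = ?B z'" using h0 by simp
  moreover have "dist (?A z) (?A x) < e"
    using z d d0 by (intro dA) (auto simp: dist_norm norm_minus_commute subset_iff)
  moreover have "dist (?B z') (?B x) < e"
    using z' d d0 by (intro dB) (auto simp: dist_norm norm_minus_commute subset_iff)
  ultimately show False unfolding e_def dist_real_def by (simp add: abs_if split: if_splits)
qed

text \<open>Pairing with a basis vector commutes with both differentiations, which reduces the claim
  to the scalar components.\<close>

lemma second_derivative_symmetric_vector:
  fixes f :: "'e::euclidean_space \<Rightarrow> 'f::euclidean_space"
  assumes S: "open S" and f: "k_times_cont_diff_on 2 S f" and x: "x \<in> S"
  shows "frechet_derivative (\<lambda>y. frechet_derivative f (at y) v) (at x) w =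
    frechet_derivative (\<lambda>y. frechet_derivative f (at y) w) (at x) v"
proof (rule euclidean_eqI)
  fix b :: 'f
  have f1: "(f has_derivative frechet_derivative f (at y)) (at y)" if "y \<in> S" for y
    by (rule k_times_cont_diff_on_SucE[OF f[unfolded numeral_2_eq_2] that])
  have f2: "(\<lambda>y. frechet_derivative f (at y) u) differentiable (at x)" for u
    using f x by (simp add: numeral_2_eq_2)
  have D1: "frechet_derivative (\<lambda>y. f y \<bullet> b) (at y) = (\<lambda>u. frechet_derivative f (at y) u \<bullet> b)"
    if "y \<in> S" for y
    by (rule frechet_derivative_at[symmetric]) (rule has_derivative_inner_left[OF f1[OF that]])
  have D2: "frechet_derivative (\<lambda>y. frechet_derivative (\<lambda>y. f y \<bullet> b) (at y) u) (at x) u' =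
      frechet_derivative (\<lambda>y. frechet_derivative f (at y) u) (at x) u' \<bullet> b" for u u'
  proof -
    have "((\<lambda>y. frechet_derivative f (at y) u \<bullet> b) has_derivative
        (\<lambda>u'. frechet_derivative (\<lambda>y. frechet_derivative f (at y) u) (at x) u' \<bullet> b)) (at x)"
      by (rule has_derivative_inner_left[OF f2[unfolded frechet_derivative_works]])
    then have "((\<lambda>y. frechet_derivative (\<lambda>y. f y \<bullet> b) (at y) u) has_derivative
        (\<lambda>u'. frechet_derivative (\<lambda>y. frechet_derivative f (at y) u) (at x) u' \<bullet> b)) (at x)"
      by (rule has_derivative_transform_within_open[OF _ S x]) (simp add: D1)
    then show ?thesis using frechet_derivative_at by metis
  qed
  have "k_times_cont_diff_on 2 S (\<lambda>y. f y \<bullet> b)"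
    by (rule k_times_cont_diff_on_linear_comp[OF bounded_linear_inner_left S f])
  from second_derivative_symmetric[OF S this x]
  show "frechet_derivative (\<lambda>y. frechet_derivative f (at y) v) (at x) w \<bullet> b =
      frechet_derivative (\<lambda>y. frechet_derivative f (at y) w) (at x) v \<bullet> b"
    unfolding D2 .
qed


subsection \<open>Convergent power series\<close>

lemma locally_power_series_onD:
  assumes "locally_power_series_on S f" "a \<in> S"
  shows "\<exists>\<rho>>0. \<exists>coef. \<forall>x\<in>ball a \<rho>.
    ((\<lambda>\<alpha>. (\<Prod>b\<in>Basis. ((x - a) \<bullet> b) ^ \<alpha> b) *\<^sub>R coef \<alpha>) has_sum f x) (Basis \<rightarrow>\<^sub>E UNIV)"
  using assms unfolding locally_power_series_on_def by blast

lemma locally_power_series_onI: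
  assumes "\<And>a. a \<in> S \<Longrightarrow> \<exists>\<rho>>0. \<exists>coef. \<forall>x\<in>ball a \<rho>.
    ((\<lambda>\<alpha>. (\<Prod>b\<in>Basis. ((x - a) \<bullet> b) ^ \<alpha> b) *\<^sub>R coef \<alpha>) has_sum f x) (Basis \<rightarrow>\<^sub>E UNIV)"
  shows "locally_power_series_on S f"
  using assms unfolding locally_power_series_on_def by blast

lemma locally_power_series_on_cong:
  assumes "open S" "locally_power_series_on S f" "\<And>x. x \<in> S \<Longrightarrow> f x = g x"
  shows "locally_power_series_on S g"
proof (rule locally_power_series_onI)
  fix a assume a: "a \<in> S"
  obtain d where d: "d > 0" "ball a d \<subseteq> S" using assms(1) a by (meson open_contains_ball)
  obtain \<rho> coef where \<rho>: "\<rho> > 0" and ser: "\<forall>x\<in>ball a \<rho>.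
    ((\<lambda>\<alpha>. (\<Prod>b\<in>Basis. ((x - a) \<bullet> b) ^ \<alpha> b) *\<^sub>R coef \<alpha>) has_sum f x) (Basis \<rightarrow>\<^sub>E UNIV)"
    using locally_power_series_onD[OF assms(2) a] by blast
  have "((\<lambda>\<alpha>. (\<Prod>b\<in>Basis. ((x - a) \<bullet> b) ^ \<alpha> b) *\<^sub>R coef \<alpha>) has_sum g x) (Basis \<rightarrow>\<^sub>E UNIV)"
    if "x \<in> ball a (min \<rho> d)" for x
    using bspec[OF ser, of x] assms(3)[of x] that d by auto
  then show "\<exists>\<rho>>0. \<exists>coef. \<forall>x\<in>ball a \<rho>.
    ((\<lambda>\<alpha>. (\<Prod>b\<in>Basis. ((x - a) \<bullet> b) ^ \<alpha> b) *\<^sub>R coef \<alpha>) has_sum g x) (Basis \<rightarrow>\<^sub>E UNIV)"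
    using \<rho> d by (intro exI[of _ "min \<rho> d"] conjI exI[of _ coef]) auto
qed

lemma locally_power_series_on_zero: "locally_power_series_on S (\<lambda>x. 0)"
  by (rule locally_power_series_onI) (auto intro!: exI[of _ "1::real"] exI[of _ "\<lambda>_. 0"])

lemma locally_power_series_on_add:
  assumes "locally_power_series_on S f" "locally_power_series_on S g"
  shows "locally_power_series_on S (\<lambda>x. f x + g x)"
proof (rule locally_power_series_onI)
  fix a assume a: "a \<in> S"
  obtain \<rho>1 c1 where 1: "\<rho>1 > 0" "\<forall>x\<in>ball a \<rho>1.
    ((\<lambda>\<alpha>. (\<Prod>b\<in>Basis. ((x - a) \<bullet> b) ^ \<alpha> b) *\<^sub>R c1 \<alpha>) has_sum f x) (Basis \<rightarrow>\<^sub>E UNIV)"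
    using locally_power_series_onD[OF assms(1) a] by blast
  obtain \<rho>2 c2 where 2: "\<rho>2 > 0" "\<forall>x\<in>ball a \<rho>2.
    ((\<lambda>\<alpha>. (\<Prod>b\<in>Basis. ((x - a) \<bullet> b) ^ \<alpha> b) *\<^sub>R c2 \<alpha>) has_sum g x) (Basis \<rightarrow>\<^sub>E UNIV)"
    using locally_power_series_onD[OF assms(2) a] by blast
  have "((\<lambda>\<alpha>. (\<Prod>b\<in>Basis. ((x - a) \<bullet> b) ^ \<alpha> b) *\<^sub>R (c1 \<alpha> + c2 \<alpha>)) has_sum f x + g x)
      (Basis \<rightarrow>\<^sub>E UNIV)" if "x \<in> ball a (min \<rho>1 \<rho>2)" for x
    unfolding scaleR_add_right using that by (intro has_sum_add 1(2)[rule_format] 2(2)[rule_format]) auto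
  then show "\<exists>\<rho>>0. \<exists>coef. \<forall>x\<in>ball a \<rho>. ((\<lambda>\<alpha>. (\<Prod>b\<in>Basis. ((x - a) \<bullet> b) ^ \<alpha> b) *\<^sub>R coef \<alpha>)
      has_sum f x + g x) (Basis \<rightarrow>\<^sub>E UNIV)"
    using 1(1) 2(1) by (intro exI[of _ "min \<rho>1 \<rho>2"] conjI exI[of _ "\<lambda>\<alpha>. c1 \<alpha> + c2 \<alpha>"]) auto
qed

lemma locally_power_series_on_linear_comp:
  assumes L: "bounded_linear L" and "locally_power_series_on S f"
  shows "locally_power_series_on S (\<lambda>x. L (f x))"
proof (rule locally_power_series_onI)
  fix a assume a: "a \<in> S"
  obtain \<rho> c where 1: "\<rho> > 0" "\<forall>x\<in>ball a \<rho>.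
    ((\<lambda>\<alpha>. (\<Prod>b\<in>Basis. ((x - a) \<bullet> b) ^ \<alpha> b) *\<^sub>R c \<alpha>) has_sum f x) (Basis \<rightarrow>\<^sub>E UNIV)"
    using locally_power_series_onD[OF assms(2) a] by blast
  have "((\<lambda>\<alpha>. (\<Prod>b\<in>Basis. ((x - a) \<bullet> b) ^ \<alpha> b) *\<^sub>R L (c \<alpha>)) has_sum L (f x))
      (Basis \<rightarrow>\<^sub>E UNIV)" if "x \<in> ball a \<rho>" for x
    using has_sum_bounded_linear[OF L 1(2)[rule_format, OF that]]
    by (simp only: linear_cmul[OF bounded_linear.linear[OF L]])
  then show "\<exists>\<rho>>0. \<exists>coef. \<forall>x\<in>ball a \<rho>. ((\<lambda>\<alpha>. (\<Prod>b\<in>Basis. ((x - a) \<bullet> b) ^ \<alpha> b) *\<^sub>R coef \<alpha>)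
      has_sum L (f x)) (Basis \<rightarrow>\<^sub>E UNIV)"
    using 1(1) by (intro exI[of _ \<rho>] conjI exI[of _ "\<lambda>\<alpha>. L (c \<alpha>)"] ballI)
qed

text \<open>Write \<open>x \<bullet> b = (x - a) \<bullet> b + a \<bullet> b\<close>; multiplication by \<open>(x - a) \<bullet> b\<close> shifts the multi-index.\<close>

lemma locally_power_series_on_coordinate_mult:
  fixes f :: "'e::euclidean_space \<Rightarrow> 'f::real_normed_vector"
  assumes b: "b \<in> Basis" and "locally_power_series_on S f"
  shows "locally_power_series_on S (\<lambda>x. (x \<bullet> b) *\<^sub>R f x)"
proof (rule locally_power_series_onI)
  fix a assume a: "a \<in> S"
  let ?mon = "\<lambda>x \<alpha>. \<Prod>b\<in>Basis. ((x - a) \<bullet> b) ^ \<alpha> b"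
  let ?E = "Basis \<rightarrow>\<^sub>E UNIV :: ('e \<Rightarrow> nat) set"
  obtain \<rho> c where \<rho>: "\<rho> > 0" and
    ser: "\<forall>x\<in>ball a \<rho>. ((\<lambda>\<alpha>. ?mon x \<alpha> *\<^sub>R c \<alpha>) has_sum f x) ?E"
    using locally_power_series_onD[OF assms(2) a] by blast
  define up :: "('e \<Rightarrow> nat) \<Rightarrow> 'e \<Rightarrow> nat" where "up \<alpha> = \<alpha>(b := Suc (\<alpha> b))" for \<alpha>
  \<comment> \<open>The coefficients of the shifted series: a monomial without the factor belonging
    to \<open>b\<close> does not occur in it, and any other takes the coefficient of the monomial
    with that exponent lowered by one.\<close>
  define c' where "c' \<beta> = (if \<beta> b = 0 then 0 else c (\<beta>(b := \<beta> b - 1)))" for \<beta>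
  have inj: "inj_on up ?E"
  proof (rule inj_onI)
    fix \<alpha> \<beta> assume eq: "up \<alpha> = up \<beta>"
    show "\<alpha> = \<beta>"
    proof
      fix z show "\<alpha> z = \<beta> z"
        using fun_cong[OF eq, of z] by (auto simp: up_def split: if_splits)
    qed
  qed
  have upE: "up ` ?E \<subseteq> ?E" using b by (auto simp: up_def PiE_iff extensional_def)
  have up_onto: "\<beta> \<in> up ` ?E" if "\<beta> \<in> ?E" "\<beta> b \<noteq> 0" for \<beta>
  proof (rule image_eqI)
    show "\<beta> = up (\<beta>(b := \<beta> b - 1))" using that by (auto simp: up_def)
    show "\<beta>(b := \<beta> b - 1) \<in> ?E" using that b by (auto simp: PiE_iff extensional_def)
  qed
  have c'up: "c' (up \<alpha>) = c \<alpha>" for \<alpha> by (simp add: c'_def up_def)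
  have mon_up: "?mon x (up \<alpha>) = ((x - a) \<bullet> b) * ?mon x \<alpha>" for x \<alpha>
  proof -
    have "(\<Prod>i\<in>Basis - {b}. ((x - a) \<bullet> i) ^ up \<alpha> i) = (\<Prod>i\<in>Basis - {b}. ((x - a) \<bullet> i) ^ \<alpha> i)"
      by (rule prod.cong) (auto simp: up_def)
    then show ?thesis
      using prod.remove[OF finite_Basis b, of "\<lambda>i. ((x - a) \<bullet> i) ^ up \<alpha> i"]
        prod.remove[OF finite_Basis b, of "\<lambda>i. ((x - a) \<bullet> i) ^ \<alpha> i"]
      by (simp add: up_def)
  qed
  have "((\<lambda>\<alpha>. ?mon x \<alpha> *\<^sub>R (c' \<alpha> + (a \<bullet> b) *\<^sub>R c \<alpha>)) has_sum (x \<bullet> b) *\<^sub>R f x) ?E"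
    if x: "x \<in> ball a \<rho>" for x
  proof -
    have "((\<lambda>\<alpha>. ((x - a) \<bullet> b) *\<^sub>R (?mon x \<alpha> *\<^sub>R c \<alpha>)) has_sum ((x - a) \<bullet> b) *\<^sub>R f x) ?E"
      by (rule has_sum_scaleR[OF ser[rule_format, OF x]])
    also have "(\<lambda>\<alpha>. ((x - a) \<bullet> b) *\<^sub>R (?mon x \<alpha> *\<^sub>R c \<alpha>)) = (\<lambda>\<beta>. ?mon x \<beta> *\<^sub>R c' \<beta>) \<circ> up"
      by (rule ext) (simp add: mon_up c'up)
    finally have "((\<lambda>\<beta>. ?mon x \<beta> *\<^sub>R c' \<beta>) has_sum ((x - a) \<bullet> b) *\<^sub>R f x) (up ` ?E)"
      unfolding has_sum_reindex[OF inj] .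
    also have "?this \<longleftrightarrow> ((\<lambda>\<beta>. ?mon x \<beta> *\<^sub>R c' \<beta>) has_sum ((x - a) \<bullet> b) *\<^sub>R f x) ?E"
    proof (rule has_sum_cong_neutral)
      show "?mon x \<beta> *\<^sub>R c' \<beta> = 0" if "\<beta> \<in> ?E - up ` ?E" for \<beta>
        using up_onto[of \<beta>] that by (auto simp: c'_def)
      show "?mon x \<beta> *\<^sub>R c' \<beta> = 0" if "\<beta> \<in> up ` ?E - ?E" for \<beta>
        using upE that by blast
    qed simp
    finally have 1: "((\<lambda>\<beta>. ?mon x \<beta> *\<^sub>R c' \<beta>) has_sum ((x - a) \<bullet> b) *\<^sub>R f x) ?E" .
    have 2: "((\<lambda>\<alpha>. (a \<bullet> b) *\<^sub>R (?mon x \<alpha> *\<^sub>R c \<alpha>)) has_sum (a \<bullet> b) *\<^sub>R f x) ?E"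
      by (rule has_sum_scaleR[OF ser[rule_format, OF x]])
    show ?thesis
      using has_sum_add[OF 1 2]
      by (simp add: scaleR_add_right inner_diff_left scaleR_diff_left mult.commute)
  qed
  then show "\<exists>\<rho>>0. \<exists>coef. \<forall>x\<in>ball a \<rho>. ((\<lambda>\<alpha>. ?mon x \<alpha> *\<^sub>R coef \<alpha>)
      has_sum (x \<bullet> b) *\<^sub>R f x) ?E"
    using \<rho> by (intro exI[of _ \<rho>] conjI exI[of _ "\<lambda>\<alpha>. c' \<alpha> + (a \<bullet> b) *\<^sub>R c \<alpha>"]) auto
qed

lemma prod_Basis_prod_eq:
  fixes g :: "'e::euclidean_space \<times> 'f::euclidean_space \<Rightarrow> 'g::comm_monoid_mult"
  shows "prod g Basis = (\<Prod>u\<in>Basis. g (u, 0)) * (\<Prod>v\<in>Basis. g (0, v))"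
proof -
  have "inj_on (\<lambda>u. (u::'e, 0::'f)) Basis" "inj_on (\<lambda>u. (0::'e, u::'f)) Basis"
    by (auto intro!: inj_onI)
  then show ?thesis
    unfolding Basis_prod_def
    by (subst prod.union_disjoint) (auto simp: Basis_prod_def prod.reindex)
qed

text \<open>The series in the base variables is reused: multi-indices with exponent zero in all
  fibre directions keep their coefficient and all others get 0. The same radius works because the
  projection does not increase distances.\<close>

lemma locally_power_series_on_fst:
  fixes f :: "'e::euclidean_space \<Rightarrow> 'g::real_normed_vector"
  assumes "locally_power_series_on S f"
  shows "locally_power_series_on (S \<times> (UNIV :: 'f::euclidean_space set)) (\<lambda>z. f (fst z))"
proof (rule locally_power_series_onI)
  fix a assume "a \<in> S \<times> (UNIV :: 'f set)"
  then have a: "fst a \<in> S" by auto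
  let ?mon1 = "\<lambda>x \<alpha>. \<Prod>b\<in>Basis. ((x - fst a) \<bullet> b) ^ \<alpha> b"
  let ?mon = "\<lambda>x \<alpha>. \<Prod>b\<in>Basis. ((x - a) \<bullet> b) ^ \<alpha> b"
  let ?E1 = "Basis \<rightarrow>\<^sub>E UNIV :: ('e \<Rightarrow> nat) set"
  let ?E = "Basis \<rightarrow>\<^sub>E UNIV :: ('e \<times> 'f \<Rightarrow> nat) set"
  obtain \<rho> c where \<rho>: "\<rho> > 0" and
    ser: "\<forall>x\<in>ball (fst a) \<rho>. ((\<lambda>\<alpha>. ?mon1 x \<alpha> *\<^sub>R c \<alpha>) has_sum f x) ?E1"
    using locally_power_series_onD[OF assms a] by blast
  \<comment> \<open>Basis vectors of the product are \<open>(u, 0)\<close> and \<open>(0, v)\<close>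
    with \<open>v\<close> nonzero, so the test \<open>snd z = 0\<close> singles out the base
    directions. The restriction to \<open>Basis\<close> keeps the multi-index extensional.\<close>
  define emb :: "('e \<Rightarrow> nat) \<Rightarrow> 'e \<times> 'f \<Rightarrow> nat"
    where "emb \<gamma> = (\<lambda>z\<in>Basis. if snd z = 0 then \<gamma> (fst z) else 0)" for \<gamma>
  define proj :: "('e \<times> 'f \<Rightarrow> nat) \<Rightarrow> 'e \<Rightarrow> nat"
    where "proj \<beta> = (\<lambda>u\<in>Basis. \<beta> (u, 0))" for \<beta>
  define c' where "c' \<beta> = (if \<beta> \<in> emb ` ?E1 then c (proj \<beta>) else 0)" for \<beta>
  have proj_emb: "proj (emb \<gamma>) = \<gamma>" if "\<gamma> \<in> ?E1" for \<gamma>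
  proof
    fix u show "proj (emb \<gamma>) u = \<gamma> u"
      using that by (auto simp: proj_def emb_def PiE_iff extensional_def Basis_prod_def)
  qed
  have inj: "inj_on emb ?E1"
    by (rule inj_on_inverseI[of _ proj], rule proj_emb)
  have embE: "emb ` ?E1 \<subseteq> ?E" by (auto simp: emb_def)
  have c'emb: "c' (emb \<gamma>) = c \<gamma>" if "\<gamma> \<in> ?E1" for \<gamma>
    using that by (simp add: c'_def proj_emb)
  have mon_emb: "?mon x (emb \<gamma>) = ?mon1 (fst x) \<gamma>" for x \<gamma>
  proof -
    have "(\<Prod>v\<in>Basis. ((x - a) \<bullet> (0, v)) ^ emb \<gamma> (0, v)) = 1"
      by (rule prod.neutral) (auto simp: emb_def nonzero_Basis Basis_prod_def)
    moreover have "(\<Prod>u\<in>Basis. ((x - a) \<bullet> (u, 0)) ^ emb \<gamma> (u, 0)) = ?mon1 (fst x) \<gamma>"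
      by (rule prod.cong) (auto simp: emb_def Basis_prod_def inner_prod_def)
    ultimately show ?thesis by (simp add: prod_Basis_prod_eq)
  qed
  have "((\<lambda>\<beta>. ?mon x \<beta> *\<^sub>R c' \<beta>) has_sum f (fst x)) ?E" if x: "x \<in> ball a \<rho>" for x
  proof -
    have "fst x \<in> ball (fst a) \<rho>"
      using x dist_fst_le[of a x] by simp
    from ser[rule_format, OF this] have "((\<lambda>\<gamma>. ?mon1 (fst x) \<gamma> *\<^sub>R c \<gamma>) has_sum f (fst x)) ?E1" .
    also have "?this \<longleftrightarrow> (((\<lambda>\<beta>. ?mon x \<beta> *\<^sub>R c' \<beta>) \<circ> emb) has_sum f (fst x)) ?E1"
      by (rule has_sum_cong) (simp add: mon_emb c'emb)
    also have "\<dots> \<longleftrightarrow> ((\<lambda>\<beta>. ?mon x \<beta> *\<^sub>R c' \<beta>) has_sum f (fst x)) (emb ` ?E1)"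
      by (rule has_sum_reindex[OF inj, symmetric])
    also have "\<dots> \<longleftrightarrow> ((\<lambda>\<beta>. ?mon x \<beta> *\<^sub>R c' \<beta>) has_sum f (fst x)) ?E"
      by (rule has_sum_cong_neutral) (use embE in \<open>auto simp: c'_def\<close>)
    finally show ?thesis .
  qed
  then show "\<exists>\<rho>>0. \<exists>coef. \<forall>x\<in>ball a \<rho>. ((\<lambda>\<alpha>. ?mon x \<alpha> *\<^sub>R coef \<alpha>) has_sum f (fst x)) ?E"
    using \<rho> by (intro exI[of _ \<rho>] conjI exI[of _ c']) auto
qed


subsection \<open>\<open>C\<^sup>r\<close> maps\<close>

text \<open>Chart expressions contain \<open>cinv\<close> and agree with explicit formulas only on
  chart images. On an open set, derivatives and local series depend only on the values
  there.\<close>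

lemma Cr_on_cong:
  assumes "open S" "Cr_on r S f" "\<And>x. x \<in> S \<Longrightarrow> f x = g x"
  shows "Cr_on r S g"
  using assms(2) k_times_cont_diff_on_cong[OF assms(1) _ assms(3)]
    locally_power_series_on_cong[OF assms(1) _ assms(3)]
  by (cases r) (simp_all only: Cr_on.simps, blast+)

lemma Cr_on_zero: "Cr_on r S (\<lambda>x. 0)"
  by (cases r) (simp_all add: k_times_cont_diff_on_const locally_power_series_on_zero)

lemma Cr_on_add:
  assumes "open S" "Cr_on r S f" "Cr_on r S g"
  shows "Cr_on r S (\<lambda>x. f x + g x)"
  using assms(2,3) k_times_cont_diff_on_add[OF assms(1)] locally_power_series_on_add
  by (cases r) (simp_all only: Cr_on.simps, blast+)

lemma Cr_on_sum:
  assumes "open S" "\<And>i. i \<in> I \<Longrightarrow> Cr_on r S (f i)"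
  shows "Cr_on r S (\<lambda>x. \<Sum>i\<in>I. f i x)"
  using assms(2)
  by (induction I rule: infinite_finite_induct) (simp_all add: Cr_on_zero Cr_on_add[OF assms(1)])

lemma Cr_on_linear_comp:
  assumes "bounded_linear L" "open S" "Cr_on r S f"
  shows "Cr_on r S (\<lambda>x. L (f x))"
  using assms(3) k_times_cont_diff_on_linear_comp[OF assms(1,2)]
    locally_power_series_on_linear_comp[OF assms(1)]
  by (cases r) (simp_all only: Cr_on.simps, blast+)

lemma Cr_on_fst:
  fixes f :: "'e::euclidean_space \<Rightarrow> 'g::real_normed_vector"
  assumes "open S" "Cr_on r S f"
  shows "Cr_on r (S \<times> (UNIV :: 'f::euclidean_space set)) (\<lambda>z. f (fst z))"
  using assms(2) k_times_cont_diff_on_fst[OF assms(1)] locally_power_series_on_fst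
  by (cases r) (simp_all only: Cr_on.simps, blast+)

lemma Cr_on_coordinate_mult:
  assumes "b \<in> Basis" "open S" "Cr_on r S f"
  shows "Cr_on r S (\<lambda>x. (x \<bullet> b) *\<^sub>R f x)"
proof -
  have "k_times_cont_diff_on k S (\<lambda>x. (x \<bullet> b) *\<^sub>R f x)" if "k_times_cont_diff_on k S f" for k
    by (rule k_times_cont_diff_on_bilinear[OF bounded_bilinear_scaleR assms(2) _ that])
      (rule k_times_cont_diff_on_linear[OF bounded_linear_inner_left])
  then show ?thesis
    using assms(3) locally_power_series_on_coordinate_mult[OF assms(1)]
    by (cases r) (simp_all only: Cr_on.simps, blast+)
qed

text \<open>This is the regularity of a momentum in a chart. Expanding the pairing in fibre
  coordinates, read off by the basis vectors \<open>(0, b)\<close>, leaves only multiplications by a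
  coordinate, which are available for power series too.\<close>

lemma Cr_on_inner_snd:
  fixes f :: "'e::euclidean_space \<Rightarrow> 'f::euclidean_space"
  assumes "open S" "Cr_on r S f"
  shows "Cr_on r (S \<times> UNIV) (\<lambda>z. snd z \<bullet> f (fst z))"
proof -
  have S: "open (S \<times> (UNIV :: 'f set))" using assms(1) by (simp add: open_Times)
  have "Cr_on r (S \<times> UNIV) (\<lambda>z. \<Sum>b\<in>Basis. (z \<bullet> (0, b)) *\<^sub>R (f (fst z) \<bullet> b))"
  proof (rule Cr_on_sum[OF S])
    fix b :: 'f assume b: "b \<in> Basis"
    have "Cr_on r (S \<times> (UNIV :: 'f set)) (\<lambda>z. f (fst z) \<bullet> b)"
      by (rule Cr_on_linear_comp[OF bounded_linear_inner_left S Cr_on_fst[OF assms]])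
    then show "Cr_on r (S \<times> UNIV) (\<lambda>z. (z \<bullet> (0, b)) *\<^sub>R (f (fst z) \<bullet> b))"
      using b by (intro Cr_on_coordinate_mult[OF _ S]) (auto simp: Basis_prod_def)
  qed
  also have "(\<lambda>z. \<Sum>b\<in>Basis. (z \<bullet> (0, b)) *\<^sub>R (f (fst z) \<bullet> b)) = (\<lambda>z. snd z \<bullet> f (fst z))"
    by (rule ext) (simp add: inner_prod_def euclidean_inner[where y = "f _", symmetric])
  finally show ?thesis .
qed

lemma Cr_on_C_fin:
  assumes "Cr_on r S f" "\<And>k. r = C_fin k \<Longrightarrow> l \<le> k"
  shows "Cr_on (C_fin l) S f"
proof (cases r)
  case (C_fin k)
  then show ?thesis using assms k_times_cont_diff_on_mono by (simp only: Cr_on.simps) blast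
qed (use assms in auto)


subsection \<open>Linearly independent families and negligible cylinders\<close>

lemma lin_indep_family_cong:
  assumes "\<And>j. j < k \<Longrightarrow> v j = w j"
  shows "lin_indep_family k v \<longleftrightarrow> lin_indep_family k w"
proof -
  have "inj_on v {..<k} \<longleftrightarrow> inj_on w {..<k}" "v ` {..<k} = w ` {..<k}"
    using assms by (auto intro!: inj_on_cong image_cong)
  then show ?thesis by (simp add: lin_indep_family_def)
qed

lemma lin_indep_family_iff:
  "lin_indep_family k v \<longleftrightarrow> (\<forall>a. (\<Sum>j<k. a j *\<^sub>R v j) = 0 \<longrightarrow> (\<forall>j<k. a j = 0))"
proof
  assume L: "lin_indep_family k v"
  then have inj: "inj_on v {..<k}" and ind: "independent (v ` {..<k})"
    by (auto simp: lin_indep_family_def)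
  show "\<forall>a. (\<Sum>j<k. a j *\<^sub>R v j) = 0 \<longrightarrow> (\<forall>j<k. a j = 0)"
  proof (intro allI impI)
    fix a :: "nat \<Rightarrow> real" and j assume 0: "(\<Sum>j<k. a j *\<^sub>R v j) = 0" and j: "j < k"
    let ?u = "\<lambda>w. a (inv_into {..<k} v w)"
    have "(\<Sum>w\<in>v ` {..<k}. ?u w *\<^sub>R w) = (\<Sum>j<k. a j *\<^sub>R v j)"
      using inj by (simp add: sum.reindex)
    then have "?u (v j) = 0"
      using j 0 by (intro independentD[OF ind, of "v ` {..<k}" ?u]) auto
    then show "a j = 0" using inj j by simp
  qed
next
  assume R: "\<forall>a. (\<Sum>j<k. a j *\<^sub>R v j) = 0 \<longrightarrow> (\<forall>j<k. a j = 0)"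
  have inj: "inj_on v {..<k}"
  proof (rule inj_onI, rule ccontr)
    fix i j assume ij: "i \<in> {..<k}" "j \<in> {..<k}" "v i = v j" "i \<noteq> j"
    \<comment> \<open>For a repeated vector the coefficients 1 at \<open>i\<close> and -1 at
      \<open>j\<close> give a nontrivial relation.\<close>
    let ?a = "\<lambda>l. (if l = i then 1 else 0) - (if l = j then 1 else 0) :: real"
    have "(\<Sum>l<k. ?a l *\<^sub>R v l) =
        (\<Sum>l<k. if l = i then v l else 0) - (\<Sum>l<k. if l = j then v l else 0)"
      unfolding sum_subtractf[symmetric] by (rule sum.cong) auto
    also have "\<dots> = 0" using ij by (simp add: sum.delta)
    finally have "?a i = 0" using R[THEN spec, of ?a] ij by blast
    then show False using ij by simp
  qed
  moreover have "independent (v ` {..<k})"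
  proof (rule independent_if_scalars_zero)
    fix u w assume 0: "(\<Sum>x\<in>v ` {..<k}. u x *\<^sub>R x) = 0" and w: "w \<in> v ` {..<k}"
    have "(\<Sum>j<k. u (v j) *\<^sub>R v j) = 0" using 0 inj by (simp add: sum.reindex)
    then show "u w = 0" using R[THEN spec, of "\<lambda>j. u (v j)"] w by blast
  qed simp
  ultimately show "lin_indep_family k v" by (simp add: lin_indep_family_def)
qed

text \<open>In a vanishing combination the second component involves only the \<open>v j\<close>,
  which kills the first \<open>m\<close> coefficients; the first component is then a relation among
  the \<open>w j\<close>. The entries \<open>u\<close> are arbitrary, as nothing is known about the
  base part of a momentum gradient.\<close>

lemma lin_indep_family_block_triangular:
  assumes v: "lin_indep_family m v" and w: "lin_indep_family l w"
  shows "lin_indep_family (m + l) (\<lambda>j. if j < m then (u j, v j) else (w (j - m), 0))"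
  unfolding lin_indep_family_iff
proof (intro allI impI)
  fix a :: "nat \<Rightarrow> real" and j
  let ?z = "\<lambda>j. if j < m then (u j, v j) else (w (j - m), 0)"
  assume 0: "(\<Sum>j<m + l. a j *\<^sub>R ?z j) = 0" and j: "j < m + l"
  have split: "(\<Sum>j<m + l. f j) = (\<Sum>j<m. f j) + (\<Sum>j<l. f (m + j))"
    for f :: "nat \<Rightarrow> 'c::comm_monoid_add"
    by (induction l) (simp_all add: add.assoc)
  have "(\<Sum>j<m + l. a j *\<^sub>R ?z j) =
      (\<Sum>j<m. (a j *\<^sub>R u j, a j *\<^sub>R v j)) + (\<Sum>j<l. (a (m + j) *\<^sub>R w j, 0))"
    unfolding split by (intro arg_cong2[of _ _ _ _ "(+)"] sum.cong) auto
  then have 1: "(\<Sum>j<m. a j *\<^sub>R u j) + (\<Sum>j<l. a (m + j) *\<^sub>R w j) = 0"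
    and 2: "(\<Sum>j<m. a j *\<^sub>R v j) = 0"
    using 0 by (simp_all add: prod_eq_iff fst_sum snd_sum)
  have am: "a j = 0" if "j < m" for j
    using v 2 that unfolding lin_indep_family_iff by blast
  then have "(\<Sum>j<l. a (m + j) *\<^sub>R w j) = 0" using 1 by simp
  then have al: "\<forall>j<l. a (m + j) = 0"
    using w[unfolded lin_indep_family_iff, THEN spec, of "\<lambda>j. a (m + j)"] by blast
  show "a j = 0"
  proof (cases "j < m")
    case False
    then obtain i where "j = m + i" using le_Suc_ex not_less by blast
    then show ?thesis using al j by simp
  qed (rule am)
qed

text \<open>Transfers null sets from a chart of the base to the induced chart of the bundle. The
  detour through a Borel null superset \<open>B\<close> is made because \<open>lborel_prod\<close>
  concerns the uncompleted measure.\<close>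

lemma negligible_cylinder:
  fixes N :: "'e::euclidean_space set"
  assumes "negligible N"
  shows "negligible (N \<times> (UNIV :: 'f::euclidean_space set))"
proof -
  have "N \<in> null_sets lebesgue" using assms by (simp add: negligible_iff_null_sets)
  then obtain B where B: "N \<subseteq> B" "B \<in> null_sets lborel"
    by (auto simp: null_sets_completion_iff2)
  have "B \<times> (UNIV :: 'f set) \<in> null_sets (lborel \<Otimes>\<^sub>M lborel)"
    by (rule lborel.times_in_null_sets1) (use B in auto)
  then have "B \<times> (UNIV :: 'f set) \<in> null_sets lborel" by (simp only: lborel_prod)
  then have "negligible (B \<times> (UNIV :: 'f set))"
    by (simp add: negligible_iff_null_sets null_sets_completionI)
  then show ?thesis by (rule negligible_subset) (use B in auto)
qed

section \<open>Coordinate gradients as representing vectors of derivatives\<close>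

lemma coord_grad_eqI:
  assumes "((F \<circ> cinv c) has_derivative (\<lambda>v. g \<bullet> v)) (at (cmap c q))"
  shows "coord_grad c F q = g"
proof -
  have "frechet_derivative (F \<circ> cinv c) (at (cmap c q)) = (\<lambda>v. g \<bullet> v)"
    using frechet_derivative_at[OF assms] by simp
  then show ?thesis by (simp add: coord_grad_def euclidean_representation)
qed

lemma has_derivative_coord_grad:
  assumes "(F \<circ> cinv c) differentiable (at (cmap c q))"
  shows "((F \<circ> cinv c) has_derivative (\<lambda>v. coord_grad c F q \<bullet> v)) (at (cmap c q))"
proof -
  let ?D = "frechet_derivative (F \<circ> cinv c) (at (cmap c q))"
  have "?D v = coord_grad c F q \<bullet> v" for v
    using frechet_derivative_Basis_expansion[OF assms, of v]
    by (simp add: coord_grad_def inner_sum_left inner_commute[of v] mult.commute)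
  then have "?D = (\<lambda>v. coord_grad c F q \<bullet> v)" ..
  then show ?thesis using assms frechet_derivative_works by metis
qed


subsection \<open>Maps between manifolds\<close>

lemma in_underlying_set: "c \<in> A \<Longrightarrow> q \<in> cdom c \<Longrightarrow> q \<in> underlying_set A"
  unfolding underlying_set_def by blast

lemma topspace_atlas_topology: "topspace (atlas_topology A) = underlying_set A"
proof
  show "topspace (atlas_topology A) \<subseteq> underlying_set A"
    by (auto simp: atlas_topology_def underlying_set_def)
  show "underlying_set A \<subseteq> topspace (atlas_topology A)"
    using openin_subset[OF openin_cdom] by (auto simp: underlying_set_def)
qed

text \<open>Continuity is tested on the generating sets of the target topology; the preimage of a
  generator is a union of pieces, one in each chart of the source.\<close>

lemma continuous_map_atlasI:
  fixes A :: "('a, 'e::euclidean_space) chart set" and B :: "('b, 'f::euclidean_space) chart set"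
  assumes inj: "\<And>c. c \<in> A \<Longrightarrow> inj_on (cmap c) (cdom c)"
    and maps: "\<And>q. q \<in> underlying_set A \<Longrightarrow> g q \<in> underlying_set B"
    and op: "\<And>c d. c \<in> A \<Longrightarrow> d \<in> B \<Longrightarrow> open (cmap c ` {q \<in> cdom c. g q \<in> cdom d})"
    and cont: "\<And>c d. c \<in> A \<Longrightarrow> d \<in> B \<Longrightarrow>
      continuous_on (cmap c ` {q \<in> cdom c. g q \<in> cdom d}) (cmap d \<circ> g \<circ> cinv c)"
  shows "continuous_map (atlas_topology A) (atlas_topology B) g"
  unfolding atlas_topology_def[of B]
proof (rule continuous_on_generated_topo)
  fix U assume "U \<in> {{q \<in> cdom d. cmap d q \<in> V} | d V. d \<in> B \<and> open V}"
  then obtain d V where d: "d \<in> B" and V: "open V" and U: "U = {q \<in> cdom d. cmap d q \<in> V}"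
    by blast
  \<comment> \<open>The coordinate image of the part of the preimage of \<open>U\<close> inside
    \<open>c\<close>; it is open by continuity of the local representative.\<close>
  define W where "W c = cmap c ` {q \<in> cdom c. g q \<in> cdom d} \<inter> (cmap d \<circ> g \<circ> cinv c) -` V"
    for c :: "('a, 'e) chart"
  have "open (W c)" if "c \<in> A" for c
    unfolding W_def by (rule continuous_open_preimage[OF cont[OF that d] op[OF that d] V])
  then have "openin (atlas_topology A) {q \<in> cdom c. cmap c q \<in> W c}" if "c \<in> A" for c
    using that unfolding atlas_topology_def by (intro topology_generated_by_Basis) blast
  then have "openin (atlas_topology A) (\<Union>c\<in>A. {q \<in> cdom c. cmap c q \<in> W c})"
    by blast
  moreover have "{q \<in> cdom c. cmap c q \<in> W c} = {q \<in> cdom c. g q \<in> U}" if "c \<in> A" for c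
    using inj[OF that] by (auto simp: W_def U inj_on_eq_iff)
  then have "(\<Union>c\<in>A. {q \<in> cdom c. cmap c q \<in> W c}) = g -` U \<inter> topspace (atlas_topology A)"
    by (auto simp: topspace_atlas_topology underlying_set_def)
  ultimately show "openin (atlas_topology A) (g -` U \<inter> topspace (atlas_topology A))"
    by simp
next
  show "g ` topspace (atlas_topology A) \<subseteq> \<Union> {{q \<in> cdom d. cmap d q \<in> V} | d V. d \<in> B \<and> open V}"
  proof
    fix y assume "y \<in> g ` topspace (atlas_topology A)"
    then have "y \<in> underlying_set B"
      using maps by (auto simp: topspace_atlas_topology)
    then obtain d where "d \<in> B" "y \<in> cdom d"
      by (auto simp: underlying_set_def)
    moreover from this have "{q \<in> cdom d. cmap d q \<in> UNIV} \<in>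
        {{q \<in> cdom d. cmap d q \<in> V} | d V. d \<in> B \<and> open V}"
      using open_UNIV by blast
    ultimately show "y \<in> \<Union> {{q \<in> cdom d. cmap d q \<in> V} | d V. d \<in> B \<and> open V}"
      by (intro UnionI) auto
  qed
qed

text \<open>Used for the inverse of an inverse: applying \<open>inv_into\<close> twice returns the
  original map only on the underlying set.\<close>

lemma Cr_map_cong:
  assumes man: "manifold s A" and g: "Cr_map r A B g"
    and eq: "\<And>q. q \<in> underlying_set A \<Longrightarrow> g q = h q"
  shows "Cr_map r A B h"
proof -
  have "continuous_map (atlas_topology A) (atlas_topology B) h"
    using g eq by (auto simp: Cr_map_def topspace_atlas_topology elim!: continuous_map_eq)
  moreover have "Cr_on r (cmap c ` {q \<in> cdom c. h q \<in> cdom d}) (cmap d \<circ> h \<circ> cinv c)"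
    if c: "c \<in> A" and d: "d \<in> B" for c d
  proof -
    have eq': "g q = h q" if "q \<in> cdom c" for q
      using eq c that by (auto simp: underlying_set_def)
    then have S: "{q \<in> cdom c. g q \<in> cdom d} = {q \<in> cdom c. h q \<in> cdom d}" by auto
    have inj: "inj_on (cmap c) (cdom c)" using man c by (auto simp: manifold_def)
    show ?thesis
      unfolding S[symmetric]
    proof (rule Cr_on_cong[OF open_preimage_chart_image[OF man g c d]])
      show "Cr_on r (cmap c ` {q \<in> cdom c. g q \<in> cdom d}) (cmap d \<circ> g \<circ> cinv c)"
        using g c d by (auto simp: Cr_map_def)
    qed (use inj eq' in auto)
  qed
  ultimately show ?thesis by (simp add: Cr_map_def)
qed

lemma diffeomorphism_inverse:
  assumes man: "manifold s A" and f: "diffeomorphism r A A f"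
  shows "diffeomorphism r A A (inv_into (underlying_set A) f)"
proof -
  let ?U = "underlying_set A"
  have bij: "bij_betw f ?U ?U" using f by (simp add: diffeomorphism_def)
  have eq: "f q = inv_into ?U (inv_into ?U f) q" if "q \<in> ?U" for q
    using inv_into_inv_into_eq[OF bij that] by simp
  have "Cr_map r A A f" using f by (simp add: diffeomorphism_def)
  then have "Cr_map r A A (inv_into ?U (inv_into ?U f))"
    by (rule Cr_map_cong[OF man _ eq])
  then show ?thesis
    using f bij_betw_inv_into[OF bij] by (simp add: diffeomorphism_def)
qed

lemma Cr_map_C_fin:
  assumes "Cr_map r A B f" "\<And>k. r = C_fin k \<Longrightarrow> l \<le> k"
  shows "Cr_map (C_fin l) A B f"
  unfolding Cr_map_def
proof (intro conjI ballI)
  fix c d assume "c \<in> A" "d \<in> B"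
  then have "Cr_on r (cmap c ` {q \<in> cdom c. f q \<in> cdom d}) (cmap d \<circ> f \<circ> cinv c)"
    using assms(1) unfolding Cr_map_def by blast
  then show "Cr_on (C_fin l) (cmap c ` {q \<in> cdom c. f q \<in> cdom d}) (cmap d \<circ> f \<circ> cinv c)"
    by (rule Cr_on_C_fin) (rule assms(2))
qed (use assms(1) in \<open>simp add: Cr_map_def\<close>)

lemma diffeomorphism_C_fin:
  assumes "diffeomorphism r A B f" "\<And>k. r = C_fin k \<Longrightarrow> l \<le> k"
  shows "diffeomorphism (C_fin l) A B f"
  unfolding diffeomorphism_def
proof (intro conjI)
  have f: "Cr_map r A B f" and g: "Cr_map r B A (inv_into (underlying_set A) f)"
    using assms(1) unfolding diffeomorphism_def by blast+
  show "Cr_map (C_fin l) A B f" by (rule Cr_map_C_fin[OF f]) (rule assms(2))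
  show "Cr_map (C_fin l) B A (inv_into (underlying_set A) f)"
    by (rule Cr_map_C_fin[OF g]) (rule assms(2))
qed (use assms(1) in \<open>simp add: diffeomorphism_def\<close>)

section \<open>Transposed Jacobians and invariance of vector fields\<close>

lemma inner_transpose_mult:
  fixes M :: "real^'n^'m"
  shows "(transpose M *v p) \<bullet> v = p \<bullet> (M *v v)"
  by (simp add: dot_lmul_matrix transpose_matrix_vector)

text \<open>Expresses the transposed Jacobian through the values of \<open>L\<close> in fixed
  directions \<open>b\<close>, the form to which the \<open>C^k\<close> calculus applies.\<close>

lemma transpose_matrix_mult:
  fixes L :: "real^'n \<Rightarrow> real^'m"
  assumes "linear L"
  shows "transpose (matrix L) *v p = (\<Sum>b\<in>Basis. (p \<bullet> L b) *\<^sub>R b)"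
proof -
  have "(transpose (matrix L) *v p) \<bullet> b = p \<bullet> L b" for b
    unfolding inner_transpose_mult using assms by (simp add: matrix_works)
  then show ?thesis
    using euclidean_representation[of "transpose (matrix L) *v p"] by simp
qed

lemma chart_jacobian_mult:
  fixes c :: "('a, real^'n::finite) chart"
  assumes "(cmap d \<circ> g \<circ> cinv c) differentiable (at (cmap c q))"
  shows "chart_jacobian g c d q *v v = frechet_derivative (cmap d \<circ> g \<circ> cinv c) (at (cmap c q)) v"
  using linear_frechet_derivative[OF assms] by (simp add: chart_jacobian_def matrix_works)

lemma flow_commute_imp_invariant:
  fixes A :: "('a, real^'n::finite) chart set"
  assumes r: "r \<noteq> C_fin 0" and man: "manifold s A" and f: "Cr_map r A A f"
    and flow: "is_flow A X \<phi>" and comm: "\<And>t q. q \<in> underlying_set A \<Longrightarrow> f (\<phi> t q) = \<phi> t (f q)"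
    and c: "c \<in> A" "q \<in> cdom c" and d: "d \<in> A" "f q \<in> cdom d"
  shows "X (f q) d = chart_jacobian f c d q *v X q c"
proof -
  let ?F = "cmap d \<circ> f \<circ> cinv c"
  have qU: "q \<in> underlying_set A" "f q \<in> underlying_set A"
    using c d by (auto simp: underlying_set_def)
  have inj: "inj_on (cmap c) (cdom c)" using man c by (auto simp: manifold_def)
  have 0: "\<phi> 0 q = q" "\<phi> 0 (f q) = f q" using flow qU by (auto simp: is_flow_def)
  have dF: "?F differentiable (at (cmap c q))"
    by (rule Cr_map_differentiable[OF f r c(1) d(1) c(2) d(2)])
  have "((\<lambda>s. cmap c (\<phi> s q)) has_vector_derivative X (\<phi> 0 q) c) (at 0)"
    using flow qU(1) c 0(1) unfolding is_flow_def by metis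
  then have v: "((\<lambda>s. cmap c (\<phi> s q)) has_vector_derivative X q c) (at 0)"
    by (simp only: 0(1))
  have "(?F has_derivative frechet_derivative ?F (at (cmap c q)))
      (at (cmap c (\<phi> 0 q)) within range (\<lambda>s. cmap c (\<phi> s q)))"
    unfolding 0(1) by (rule has_derivative_at_withinI[OF dF[unfolded frechet_derivative_works]])
  from vector_derivative_diff_chain_within[OF v this]
  have "((?F \<circ> (\<lambda>s. cmap c (\<phi> s q))) has_vector_derivative
      frechet_derivative ?F (at (cmap c q)) (X q c)) (at 0)" .
  \<comment> \<open>The chain rule has differentiated the image of the orbit of \<open>q\<close>. It
    coincides with the orbit of \<open>f q\<close>, read in \<open>d\<close>, while the orbit of
    \<open>q\<close> stays in \<open>cdom c\<close>, and by continuity these times form an open set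
    containing 0.\<close>
  then have 1: "((\<lambda>s. cmap d (\<phi> s (f q))) has_vector_derivative
      frechet_derivative ?F (at (cmap c q)) (X q c)) (at 0)"
  proof (rule has_vector_derivative_transform_within_open)
    have "continuous_map euclideanreal (atlas_topology A) (\<lambda>t. \<phi> t q)"
      using flow qU(1) by (auto simp: is_flow_def)
    from openin_continuous_map_preimage[OF this openin_cdom[OF c(1)]]
    show "open {t. \<phi> t q \<in> cdom c}" by simp
    show "0 \<in> {t. \<phi> t q \<in> cdom c}" using c 0 by simp
    show "(?F \<circ> (\<lambda>s. cmap c (\<phi> s q))) t = cmap d (\<phi> t (f q))" if "t \<in> {t. \<phi> t q \<in> cdom c}" for t
      using that inj comm[OF qU(1)] by simp
  qed
  have 2: "((\<lambda>s. cmap d (\<phi> s (f q))) has_vector_derivative X (\<phi> 0 (f q)) d) (at 0)"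
    using flow qU(2) d 0(2) unfolding is_flow_def by metis
  show ?thesis
    using vector_derivative_unique_at[OF 2 1] 0(2) chart_jacobian_mult[OF dF] by simp
qed


subsection \<open>Charts of the cotangent bundle\<close>

locale smooth_atlas =
  fixes A :: "('a, real^'n::finite) chart set" and s :: regularity
  assumes man: "manifold s A" and s: "s \<noteq> C_fin 0"
begin

lemma chart_inj: "c \<in> A \<Longrightarrow> inj_on (cmap c) (cdom c)"
  and chart_open: "c \<in> A \<Longrightarrow> open (cmap c ` cdom c)"
  using man by (auto simp: manifold_def)

text \<open>The cocycle rule for coordinate changes; it makes the components of
  \<open>covector\<close> in different charts compatible.\<close>

lemma transition_jacobian_compose:
  assumes "c \<in> A" "d \<in> A" "e \<in> A" "q \<in> cdom c" "q \<in> cdom d" "q \<in> cdom e"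
  shows "chart_jacobian id c e q = chart_jacobian id d e q ** chart_jacobian id c d q"
proof -
  have diff: "(cmap d \<circ> id \<circ> cinv c) differentiable (at (cmap c q))"
    if "c \<in> A" "d \<in> A" "q \<in> cdom c" "q \<in> cdom d" for c d
  proof -
    have "Cr_on s (cmap c ` (cdom c \<inter> cdom d)) (cmap d \<circ> cinv c)"
      using man that by (auto simp: manifold_def)
    from Cr_on_differentiable[OF this s, of "cmap c q"] that show ?thesis by simp
  qed
  have op: "open (cmap c ` {q \<in> cdom c. id q \<in> cdom d})"
    using man assms by (auto simp: manifold_def Int_def)
  have "chart_jacobian (id \<circ> id) c e q = chart_jacobian id d e (id q) ** chart_jacobian id c d q"
  proof (rule jacobian_compose[where g = id, OF chart_inj chart_inj _ _ op])
    show "(cmap d \<circ> id \<circ> cinv c) differentiable (at (cmap c q))"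
      "(cmap e \<circ> id \<circ> cinv d) differentiable (at (cmap d (id q)))"
      using diff[of c d] diff[of d e] assms by (simp_all only: id_apply)
  qed (use assms in simp_all)
  then show ?thesis by simp
qed

text \<open>The point of the fibre over \<open>q\<close> with prescribed components \<open>v\<close>
  in the chart \<open>c\<close>. It shows that fibre coordinates attain every value.\<close>

definition covector :: "('a, real^'n) chart \<Rightarrow> 'a \<Rightarrow> real^'n \<Rightarrow> ('a, 'n) covec" where
  "covector c q v =
    (\<lambda>d. if d \<in> A \<and> q \<in> cdom d then transpose (chart_jacobian id d c q) *v v else 0)"

lemma covector_in_bundle:
  assumes "c \<in> A" "q \<in> cdom c"
  shows "(q, covector c q v) \<in> cotangent_bundle A"
proof -
  have "covector c q v d = transpose (chart_jacobian id d e q) *v covector c q v e"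
    if "d \<in> A" "e \<in> A" "q \<in> cdom d \<inter> cdom e" for d e
    using transition_jacobian_compose[of d e c q] assms that
    by (simp add: covector_def matrix_transpose_mul matrix_vector_mul_assoc
        del: transpose_matrix_vector)
  moreover have "covector c q v d = 0" if "\<not> (d \<in> A \<and> q \<in> cdom d)" for d
    using that by (auto simp: covector_def)
  moreover have "q \<in> underlying_set A" using assms by (auto simp: underlying_set_def)
  ultimately show ?thesis unfolding cotangent_bundle_def by blast
qed

lemma covector_same_chart:
  assumes "c \<in> A" "q \<in> cdom c"
  shows "covector c q v c = v"
  using assms jacobian_id[OF chart_open chart_inj] by (simp add: covector_def)

lemma cotangent_bundle_transform:
  assumes "(q, p) \<in> cotangent_bundle A" "c \<in> A" "d \<in> A" "q \<in> cdom c" "q \<in> cdom d"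
  shows "p c = transpose (chart_jacobian id c d q) *v p d"
proof -
  have "\<forall>c\<in>A. \<forall>d\<in>A. q \<in> cdom c \<inter> cdom d \<longrightarrow>
      p c = transpose (chart_jacobian id c d q) *v p d"
    using assms(1) unfolding cotangent_bundle_def by blast
  with assms(2-) show ?thesis by blast
qed

text \<open>The transformation law determines the components in all charts around the base point,
  and the zero convention determines the values at all other arguments.\<close>

lemma cotangent_bundle_eqI:
  assumes "(q, p) \<in> cotangent_bundle A" "(q, p') \<in> cotangent_bundle A"
    and "c \<in> A" "q \<in> cdom c" "p c = p' c"
  shows "p = p'"
proof
  fix d
  show "p d = p' d"
  proof (cases "d \<in> A \<and> q \<in> cdom d")
    case True
    with cotangent_bundle_transform[OF assms(1), of d c] cotangent_bundle_transform[OF assms(2), of d c]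
      assms(3-) show ?thesis by metis
  next
    case False
    then have "p d = 0" "p' d = 0" using assms(1,2) unfolding cotangent_bundle_def by blast+
    then show ?thesis by simp
  qed
qed

lemma in_cotangent_cdom:
  "(q, p) \<in> cdom (cotangent_chart A c) \<longleftrightarrow> (q, p) \<in> cotangent_bundle A \<and> q \<in> cdom c"
  by (simp add: cotangent_chart_def)

lemma cotangent_cmap: "cmap (cotangent_chart A c) (q, p) = (cmap c q, p c)"
  by (simp add: cotangent_chart_def)

lemma cotangent_chart_inj:
  assumes "c \<in> A"
  shows "inj_on (cmap (cotangent_chart A c)) (cdom (cotangent_chart A c))"
proof (rule inj_onI)
  fix y y' assume y: "y \<in> cdom (cotangent_chart A c)" "y' \<in> cdom (cotangent_chart A c)"
    and eq: "cmap (cotangent_chart A c) y = cmap (cotangent_chart A c) y'"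
  obtain q p q' p' where [simp]: "y = (q, p)" "y' = (q', p')" by fastforce
  have "q = q'"
    using y eq chart_inj[OF assms] by (auto simp: in_cotangent_cdom cotangent_cmap inj_on_eq_iff)
  then show "y = y'"
    using y eq assms cotangent_bundle_eqI[of q p p' c]
    by (simp add: in_cotangent_cdom cotangent_cmap)
qed

text \<open>Fibres are full, since \<open>covector\<close> realises every \<open>p\<close>. The
  predicate on base points allows one statement to serve chart domains, preimages under a lift and
  exceptional null sets.\<close>

lemma cotangent_chart_image:
  assumes c: "c \<in> A"
  shows "cmap (cotangent_chart A c) ` {y \<in> cdom (cotangent_chart A c). P (fst y)} =
    cmap c ` {q \<in> cdom c. P q} \<times> UNIV"
proof (intro equalityI subsetI)
  fix z assume "z \<in> cmap c ` {q \<in> cdom c. P q} \<times> (UNIV :: (real^'n) set)"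
  then obtain q where q: "q \<in> cdom c" "P q" "fst z = cmap c q" by auto
  have "(q, covector c q (snd z)) \<in> {y \<in> cdom (cotangent_chart A c). P (fst y)}"
    using q c covector_in_bundle by (simp add: in_cotangent_cdom)
  moreover have "cmap (cotangent_chart A c) (q, covector c q (snd z)) = z"
    using q c covector_same_chart by (simp add: cotangent_cmap prod_eq_iff)
  ultimately show "z \<in> cmap (cotangent_chart A c) ` {y \<in> cdom (cotangent_chart A c). P (fst y)}"
    by (rule rev_image_eqI[OF _ sym])
next
  fix z assume "z \<in> cmap (cotangent_chart A c) ` {y \<in> cdom (cotangent_chart A c). P (fst y)}"
  then obtain q p where "z = cmap (cotangent_chart A c) (q, p)"
    "(q, p) \<in> cdom (cotangent_chart A c)" "P q" by force
  then show "z \<in> cmap c ` {q \<in> cdom c. P q} \<times> (UNIV :: (real^'n) set)"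
    by (simp add: in_cotangent_cdom cotangent_cmap)
qed

lemma cotangent_chart_image_all:
  assumes "c \<in> A"
  shows "cmap (cotangent_chart A c) ` cdom (cotangent_chart A c) = cmap c ` cdom c \<times> UNIV"
  using cotangent_chart_image[OF assms, of "\<lambda>_. True"] by simp

text \<open>Makes the choice hidden in the inverse chart harmless: injectivity of \<open>c\<close>
  identifies the base point, and the covector enters computations through its membership in the
  bundle and its component in \<open>c\<close>.\<close>

lemma cotangent_cinv:
  assumes c: "c \<in> A" and z: "z \<in> cmap c ` cdom c \<times> UNIV"
  obtains p where "cinv (cotangent_chart A c) z = (cinv c (fst z), p)" "p c = snd z"
    "(cinv c (fst z), p) \<in> cotangent_bundle A" "cinv c (fst z) \<in> cdom c"
proof -
  let ?C = "cotangent_chart A c"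
  obtain q p where qp: "cinv ?C z = (q, p)" by fastforce
  have z': "z \<in> cmap ?C ` cdom ?C" using z by (simp only: cotangent_chart_image_all[OF c])
  have 1: "(q, p) \<in> cotangent_bundle A" "q \<in> cdom c"
    using inv_into_into[OF z'] by (simp_all add: qp in_cotangent_cdom)
  have 2: "cmap c q = fst z" "p c = snd z"
    using f_inv_into_f[OF z'] by (auto simp: qp cotangent_cmap)
  have "cinv c (fst z) = q" using 1 2(1)[symmetric] chart_inj[OF c] by simp
  then show thesis using that[of p] qp 1 2 by simp
qed

lemma underlying_cotangent_atlas: "underlying_set (cotangent_atlas A) = cotangent_bundle A"
proof
  show "cotangent_bundle A \<subseteq> underlying_set (cotangent_atlas A)"
  proof
    fix y assume y: "y \<in> cotangent_bundle A"
    then obtain c where "c \<in> A" "fst y \<in> cdom c"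
      by (auto simp: cotangent_bundle_def underlying_set_def)
    with y show "y \<in> underlying_set (cotangent_atlas A)"
      by (auto simp: underlying_set_def cotangent_atlas_def cotangent_chart_def)
  qed
qed (auto simp: underlying_set_def cotangent_atlas_def cotangent_chart_def)


subsection \<open>Functions on the cotangent bundle\<close>

text \<open>The fibrewise linear function \<open>\<langle>p, X(q)\<rangle>\<close>, computed in a
  chosen chart; \<open>momentum_chart\<close> shows that the choice is immaterial.\<close>

definition momentum :: "('a, 'n) vfield \<Rightarrow> 'a \<times> ('a, 'n) covec \<Rightarrow> real" where
  "momentum X = (\<lambda>(q, p). let c = (SOME c. c \<in> A \<and> q \<in> cdom c) in p c \<bullet> X q c)"

text \<open>Vectors transform by the Jacobian of the coordinate change and covectors by its
  transpose in the opposite direction, so the pairing is preserved.\<close>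

lemma momentum_chart:
  assumes X: "vector_field A X" and y: "(q, p) \<in> cotangent_bundle A" and c: "c \<in> A" "q \<in> cdom c"
  shows "momentum X (q, p) = p c \<bullet> X q c"
proof -
  define c0 where "c0 = (SOME c. c \<in> A \<and> q \<in> cdom c)"
  have c0: "c0 \<in> A" "q \<in> cdom c0"
    using someI[of "\<lambda>c. c \<in> A \<and> q \<in> cdom c" c] c unfolding c0_def by auto
  have "X q c0 = chart_jacobian id c c0 q *v X q c"
    using X c c0 unfolding vector_field_def by blast
  moreover have "p c = transpose (chart_jacobian id c c0 q) *v p c0"
    by (rule cotangent_bundle_transform[OF y]) (use c c0 in auto)
  ultimately show ?thesis
    by (simp add: momentum_def c0_def[symmetric] inner_transpose_mult
        del: transpose_matrix_vector)
qed

lemma momentum_in_chart: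
  assumes X: "vector_field A X" and c: "c \<in> A" and z: "z \<in> cmap c ` cdom c \<times> UNIV"
  shows "(momentum X \<circ> cinv (cotangent_chart A c)) z = snd z \<bullet> X (cinv c (fst z)) c"
proof (rule cotangent_cinv[OF c z])
  fix p assume p: "cinv (cotangent_chart A c) z = (cinv c (fst z), p)" "p c = snd z"
    "(cinv c (fst z), p) \<in> cotangent_bundle A" "cinv c (fst z) \<in> cdom c"
  show ?thesis using momentum_chart[OF X p(3) c p(4)] p(2) by (simp add: p(1))
qed

lemma base_function_in_chart:
  assumes c: "c \<in> A" and z: "z \<in> cmap c ` cdom c \<times> UNIV"
  shows "((F \<circ> fst) \<circ> cinv (cotangent_chart A c)) z = (F \<circ> cinv c) (fst z)"
  by (rule cotangent_cinv[OF c z]) simp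

lemma open_cylinder: "c \<in> A \<Longrightarrow> open (cmap c ` cdom c \<times> (UNIV :: (real^'n) set))"
  using chart_open by (simp add: open_Times)

lemma Cr_function_momentum:
  assumes "Cr_vector_field r A X"
  shows "Cr_function r (cotangent_atlas A) (momentum X)"
proof -
  have "Cr_on r (cmap c ` cdom c \<times> UNIV) (momentum X \<circ> cinv (cotangent_chart A c))"
    if c: "c \<in> A" for c
  proof (rule Cr_on_cong[OF open_cylinder[OF c] Cr_on_inner_snd[OF chart_open[OF c]]])
    show "Cr_on r (cmap c ` cdom c) (\<lambda>x. X (cinv c x) c)"
      using assms c by (auto simp: Cr_vector_field_def)
    have X: "vector_field A X" using assms by (simp add: Cr_vector_field_def)
    show "snd z \<bullet> X (cinv c (fst z)) c = (momentum X \<circ> cinv (cotangent_chart A c)) z"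
      if "z \<in> cmap c ` cdom c \<times> UNIV" for z
      by (rule momentum_in_chart[OF X c that, symmetric])
  qed
  then show ?thesis
    by (auto simp: Cr_function_def cotangent_atlas_def cotangent_chart_image_all)
qed

lemma Cr_function_base:
  assumes "Cr_function r A F"
  shows "Cr_function r (cotangent_atlas A) (F \<circ> fst)"
proof -
  have "Cr_on r (cmap c ` cdom c \<times> UNIV) ((F \<circ> fst) \<circ> cinv (cotangent_chart A c))"
    if c: "c \<in> A" for c
  proof (rule Cr_on_cong[OF open_cylinder[OF c] Cr_on_fst[OF chart_open[OF c]]])
    show "Cr_on r (cmap c ` cdom c) (F \<circ> cinv c)"
      using assms c by (auto simp: Cr_function_def)
    show "(F \<circ> cinv c) (fst z) = ((F \<circ> fst) \<circ> cinv (cotangent_chart A c)) z"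
      if "z \<in> cmap c ` cdom c \<times> UNIV" for z
      by (rule base_function_in_chart[OF c that, symmetric])
  qed
  then show ?thesis
    by (auto simp: Cr_function_def cotangent_atlas_def cotangent_chart_image_all)
qed

text \<open>The product rule for \<open>p \<bullet> X(x)\<close>: varying \<open>p\<close> leaves
  \<open>X\<close>, and varying \<open>x\<close> gives \<open>p \<bullet> DX(x) v\<close>, where the
  adjoint isolates the direction \<open>v\<close>.\<close>

lemma coord_grad_momentum:
  assumes r: "r \<noteq> C_fin 0" and X: "Cr_vector_field r A X"
    and c: "c \<in> A" and y: "(q, p) \<in> cotangent_bundle A" "q \<in> cdom c"
  shows "coord_grad (cotangent_chart A c) (momentum X) (q, p) =
    (adjoint (frechet_derivative (\<lambda>x. X (cinv c x) c) (at (cmap c q))) (p c), X q c)"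
proof (rule coord_grad_eqI)
  let ?Y = "\<lambda>x. X (cinv c x) c"
  let ?D = "frechet_derivative ?Y (at (cmap c q))"
  let ?z = "(cmap c q, p c)"
  have Xv: "vector_field A X" and "Cr_on r (cmap c ` cdom c) ?Y"
    using X c by (auto simp: Cr_vector_field_def)
  then have "?Y differentiable (at (cmap c q))"
    using Cr_on_differentiable r y by blast
  then have D: "(?Y has_derivative ?D) (at (fst ?z))" and lin: "linear ?D"
    using frechet_derivative_works linear_frechet_derivative by auto
  have Yq: "?Y (cmap c q) = X q c" using y chart_inj[OF c] by simp
  have "((\<lambda>z. ?Y (fst z)) has_derivative (\<lambda>v. ?D (fst v))) (at ?z)"
    by (rule has_derivative_compose[OF has_derivative_fst[OF has_derivative_ident] D])
  then have "((\<lambda>z. snd z \<bullet> ?Y (fst z)) has_derivative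
      (\<lambda>v. snd ?z \<bullet> ?D (fst v) + snd v \<bullet> ?Y (fst ?z))) (at ?z)"
    by (intro has_derivative_inner has_derivative_snd has_derivative_ident)
  also have "(\<lambda>v. snd ?z \<bullet> ?D (fst v) + snd v \<bullet> ?Y (fst ?z)) =
      (\<lambda>v. (adjoint ?D (p c), X q c) \<bullet> v)"
    using adjoint_works[OF lin] Yq
    by (intro ext) (simp add: inner_prod_def inner_commute)
  finally show "((momentum X \<circ> cinv (cotangent_chart A c)) has_derivative
      (\<lambda>v. (adjoint ?D (p c), X q c) \<bullet> v)) (at (cmap (cotangent_chart A c) (q, p)))"
    unfolding cotangent_cmap
  proof (rule has_derivative_transform_within_open[OF _ open_cylinder[OF c]])
    show "?z \<in> cmap c ` cdom c \<times> UNIV" using y by simp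
    show "snd z \<bullet> ?Y (fst z) = (momentum X \<circ> cinv (cotangent_chart A c)) z"
      if "z \<in> cmap c ` cdom c \<times> UNIV" for z
      by (rule momentum_in_chart[OF Xv c that, symmetric])
  qed
qed

lemma coord_grad_base:
  assumes r: "r \<noteq> C_fin 0" and F: "Cr_function r A F" and c: "c \<in> A" "q \<in> cdom c"
  shows "coord_grad (cotangent_chart A c) (F \<circ> fst) (q, p) = (coord_grad c F q, 0)"
proof (rule coord_grad_eqI)
  let ?z = "(cmap c q, p c)"
  have "Cr_on r (cmap c ` cdom c) (F \<circ> cinv c)"
    using F c by (auto simp: Cr_function_def)
  then have "(F \<circ> cinv c) differentiable (at (cmap c q))"
    using Cr_on_differentiable r c by blast
  from has_derivative_coord_grad[OF this]
  have D: "((F \<circ> cinv c) has_derivative (\<lambda>v. coord_grad c F q \<bullet> v)) (at (fst ?z))" by simp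
  have "((\<lambda>z. (F \<circ> cinv c) (fst z)) has_derivative (\<lambda>v. coord_grad c F q \<bullet> fst v)) (at ?z)"
    by (rule has_derivative_compose[OF has_derivative_fst[OF has_derivative_ident] D])
  also have "(\<lambda>v. coord_grad c F q \<bullet> fst v) = (\<lambda>v. (coord_grad c F q, 0 :: real^'n) \<bullet> v)"
    by (simp add: inner_prod_def)
  finally show "(((F \<circ> fst) \<circ> cinv (cotangent_chart A c)) has_derivative
      (\<lambda>v. (coord_grad c F q, 0) \<bullet> v)) (at (cmap (cotangent_chart A c) (q, p)))"
    unfolding cotangent_cmap
  proof (rule has_derivative_transform_within_open[OF _ open_cylinder[OF c(1)]])
    show "?z \<in> cmap c ` cdom c \<times> UNIV" using c by simp
    show "(F \<circ> cinv c) (fst z) = ((F \<circ> fst) \<circ> cinv (cotangent_chart A c)) z"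
      if "z \<in> cmap c ` cdom c \<times> UNIV" for z
      by (rule base_function_in_chart[OF c(1) that, symmetric])
  qed
qed

section \<open>Poisson brackets of the integrals\<close>

text \<open>Moving the adjoints across the inner products turns the bracket into
  \<open>p \<bullet> (DX Y - DY X)\<close>, and \<open>lie_bracket\<close> has the opposite order,
  whence the sign.\<close>

lemma poisson_momentum_momentum:
  assumes r: "r \<noteq> C_fin 0" and X: "Cr_vector_field r A X" and Y: "Cr_vector_field r A Y"
    and c: "c \<in> A" and y: "(q, p) \<in> cotangent_bundle A" "q \<in> cdom c"
  shows "poisson_bracket (cotangent_chart A c) (momentum X) (momentum Y) (q, p) =
    - (p c \<bullet> lie_bracket X Y q c)"
proof -
  have lin: "linear (frechet_derivative (\<lambda>x. Z (cinv c x) c) (at (cmap c q)))"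
    if "Cr_vector_field r A Z" for Z
  proof (rule linear_frechet_derivative)
    have "Cr_on r (cmap c ` cdom c) (\<lambda>x. Z (cinv c x) c)"
      using that c by (auto simp: Cr_vector_field_def)
    then show "(\<lambda>x. Z (cinv c x) c) differentiable (at (cmap c q))"
      using Cr_on_differentiable r y by blast
  qed
  show ?thesis
    using adjoint_works[OF lin[OF X]] adjoint_works[OF lin[OF Y]]
    by (simp add: poisson_bracket_def coord_grad_momentum[OF r _ c y] X Y lie_bracket_def
        inner_diff_right inner_commute)
qed

lemma poisson_momentum_base:
  assumes r: "r \<noteq> C_fin 0" and X: "Cr_vector_field r A X" and F: "Cr_function r A F"
    and c: "c \<in> A" and y: "(q, p) \<in> cotangent_bundle A" "q \<in> cdom c"
  shows "poisson_bracket (cotangent_chart A c) (momentum X) (F \<circ> fst) (q, p) =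
    - derivation_along X F q c"
proof -
  have "Cr_on r (cmap c ` cdom c) (F \<circ> cinv c)"
    using F c by (auto simp: Cr_function_def)
  then have "(F \<circ> cinv c) differentiable (at (cmap c q))"
    using Cr_on_differentiable r y by blast
  from has_derivative_coord_grad[OF this]
  have "frechet_derivative (F \<circ> cinv c) (at (cmap c q)) = (\<lambda>v. coord_grad c F q \<bullet> v)"
    using frechet_derivative_at by metis
  then show ?thesis
    by (simp add: poisson_bracket_def coord_grad_momentum[OF r X c y] coord_grad_base[OF r F c y(2)]
        derivation_along_def inner_commute)
qed

lemma poisson_bracket_antisym: "poisson_bracket C G H y = - poisson_bracket C H G y"
  by (simp add: poisson_bracket_def inner_commute)

lemma poisson_base_base:
  assumes "r \<noteq> C_fin 0" "Cr_function r A F" "Cr_function r A F'" "c \<in> A" "q \<in> cdom c"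
  shows "poisson_bracket (cotangent_chart A c) (F \<circ> fst) (F' \<circ> fst) (q, p) = 0"
  using assms by (simp add: poisson_bracket_def coord_grad_base)

text \<open>Independence of the fields and of the differentials at the base point suffices, whatever
  the covector. The exceptional set therefore lies in the cylinder over a union of two null
  sets.\<close>

lemma differentials_independent_ae_cotangent:
  assumes r: "r \<noteq> C_fin 0"
    and X: "\<And>j. j < m \<Longrightarrow> Cr_vector_field r A (X j)" and F: "\<And>k. k < l \<Longrightarrow> Cr_function r A (F k)"
    and Xi: "vector_fields_independent_ae A m X" and Fi: "differentials_independent_ae A l F"
  shows "differentials_independent_ae (cotangent_atlas A) (m + l)
    (\<lambda>j. if j < m then momentum (X j) else F (j - m) \<circ> fst)"
    (is "differentials_independent_ae _ _ ?G")
proof -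
  define PX where "PX q \<longleftrightarrow> (\<forall>c\<in>A. q \<in> cdom c \<longrightarrow> lin_indep_family m (\<lambda>j. X j q c))" for q
  define PF where
    "PF q \<longleftrightarrow> (\<forall>c\<in>A. q \<in> cdom c \<longrightarrow> lin_indep_family l (\<lambda>j. coord_grad c (F j) q))" for q
  define PG where "PG y \<longleftrightarrow> (\<forall>C\<in>cotangent_atlas A. y \<in> cdom C \<longrightarrow>
    lin_indep_family (m + l) (\<lambda>j. coord_grad C (?G j) y))" for y
  have good: "PG y" if "PX (fst y)" "PF (fst y)" for y
    unfolding PG_def cotangent_atlas_def
  proof (intro ballI impI)
    fix C assume "C \<in> cotangent_chart A ` A" and yC: "y \<in> cdom C"
    then obtain c where c: "c \<in> A" and C: "C = cotangent_chart A c" by blast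
    obtain q p where y: "y = (q, p)" by fastforce
    have q: "(q, p) \<in> cotangent_bundle A" "q \<in> cdom c"
      using yC by (simp_all add: C y in_cotangent_cdom)
    let ?u = "\<lambda>j. adjoint (frechet_derivative (\<lambda>x. X j (cinv c x) c) (at (cmap c q))) (p c)"
    have eq: "coord_grad C (?G j) y =
        (if j < m then (?u j, X j q c) else (coord_grad c (F (j - m)) q, 0))" if "j < m + l" for j
      using that coord_grad_momentum[OF r X c q] coord_grad_base[OF r F c q(2)]
      by (simp add: C y)
    have "lin_indep_family (m + l)
        (\<lambda>j. if j < m then (?u j, X j q c) else (coord_grad c (F (j - m)) q, 0))"
      using that c q by (intro lin_indep_family_block_triangular) (simp_all add: PX_def PF_def y)
    then show "lin_indep_family (m + l) (\<lambda>j. coord_grad C (?G j) y)"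
      by (rule lin_indep_family_cong[THEN iffD2, rotated]) (rule eq)
  qed
  have "negligible (cmap C ` {y \<in> cdom C. \<not> PG y})" if CT: "C \<in> cotangent_atlas A" for C
  proof -
    obtain c where c: "c \<in> A" and C: "C = cotangent_chart A c"
      using CT unfolding cotangent_atlas_def by blast
    have "negligible (cmap c ` {q \<in> cdom c. \<not> PX q})" "negligible (cmap c ` {q \<in> cdom c. \<not> PF q})"
      using Xi Fi c unfolding vector_fields_independent_ae_def differentials_independent_ae_def
        almost_everywhere_def PX_def PF_def by blast+
    then have "negligible (cmap c ` {q \<in> cdom c. \<not> PX q} \<union> cmap c ` {q \<in> cdom c. \<not> PF q})"
      by (rule negligible_Un)
    also have "cmap c ` {q \<in> cdom c. \<not> PX q} \<union> cmap c ` {q \<in> cdom c. \<not> PF q} =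
        cmap c ` {q \<in> cdom c. \<not> PX q \<or> \<not> PF q}" by blast
    finally have "negligible (cmap c ` {q \<in> cdom c. \<not> PX q \<or> \<not> PF q} \<times> (UNIV :: (real^'n) set))"
      by (rule negligible_cylinder)
    then have "negligible (cmap C ` {y \<in> cdom C. \<not> PX (fst y) \<or> \<not> PF (fst y)})"
      unfolding C cotangent_chart_image[OF c, of "\<lambda>q. \<not> PX q \<or> \<not> PF q"] .
    then show ?thesis
      by (rule negligible_subset) (use good in blast)
  qed
  then show ?thesis
    unfolding differentials_independent_ae_def almost_everywhere_def PG_def by blast
qed


subsection \<open>The cotangent lift\<close>

lemma fst_cotangent_lift: "fst (cotangent_lift A f y) = f (fst y)"
  by (cases y) (simp add: cotangent_lift_def)

lemma lift_in_bundle: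
  assumes "r \<noteq> C_fin 0" "diffeomorphism r A A f" "y \<in> cotangent_bundle A"
  shows "cotangent_lift A f y \<in> cotangent_bundle A"
  using cotangent_lift_in_bundle[OF assms(1) man s assms(2), of "fst y" "snd y"] assms(3) by simp

text \<open>One Jacobian relates both the covectors, transposed, and the vectors; it crosses the
  inner product, and no inverse matrix appears.\<close>

lemma momentum_cotangent_lift:
  assumes r: "r \<noteq> C_fin 0" and f: "diffeomorphism r A A f" and X: "vector_field A X"
    and inv: "\<And>c d q. c \<in> A \<Longrightarrow> q \<in> cdom c \<Longrightarrow> d \<in> A \<Longrightarrow> f q \<in> cdom d \<Longrightarrow>
      X (f q) d = chart_jacobian f c d q *v X q c"
    and y: "y \<in> cotangent_bundle A"
  shows "momentum X (cotangent_lift A f y) = momentum X y"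
proof -
  obtain q p where y_eq: "y = (q, p)" by fastforce
  obtain P where P: "cotangent_lift A f (q, p) = (f q, P)"
    by (metis fst_cotangent_lift fst_conv prod.collapse)
  have in1: "(q, p) \<in> cotangent_bundle A" using y by (simp add: y_eq)
  have in2: "(f q, P) \<in> cotangent_bundle A"
    using lift_in_bundle[OF r f y] by (simp add: y_eq P)
  obtain c d where c: "c \<in> A" "q \<in> cdom c" and d: "d \<in> A" "f q \<in> cdom d"
    using in1 in2 by (auto simp: cotangent_bundle_def underlying_set_def)
  have "p c = transpose (chart_jacobian f c d q) *v P d"
    using cotangent_lift_coords[OF r man s f in1 c d] by (simp only: P snd_conv)
  then have "p c \<bullet> X q c = P d \<bullet> X (f q) d"
    by (simp only: inner_transpose_mult inv[OF c d])
  then show ?thesis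
    by (simp only: y_eq P momentum_chart[OF X in1 c] momentum_chart[OF X in2 d])
qed

section \<open>Inverse and regularity of the lift\<close>

text \<open>By the chain rule the Jacobians of \<open>g\<close> and \<open>f\<close> multiply to the
  identity, so the coordinate identities of the two lifts combine to \<open>p c = P' c\<close>, and
  one chart decides. A left inverse is assumed so that exchanging \<open>f\<close> and
  \<open>g\<close> gives the other side.\<close>

lemma cotangent_lift_left_inverse:
  assumes r: "r \<noteq> C_fin 0" and f: "diffeomorphism r A A f" and g: "diffeomorphism r A A g"
    and gf: "\<And>q. q \<in> underlying_set A \<Longrightarrow> g (f q) = q"
    and y: "y \<in> cotangent_bundle A"
  shows "cotangent_lift A g (cotangent_lift A f y) = y"
proof -
  obtain q p where y_eq: "y = (q, p)" by fastforce
  have in1: "(q, p) \<in> cotangent_bundle A" using y by (simp add: y_eq)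
  have qU: "q \<in> underlying_set A" using in1 by (simp add: cotangent_bundle_def)
  obtain P where P: "cotangent_lift A f (q, p) = (f q, P)"
    by (metis fst_cotangent_lift fst_conv prod.collapse)
  have in2: "(f q, P) \<in> cotangent_bundle A"
    using lift_in_bundle[OF r f y] by (simp add: y_eq P)
  obtain P' where P': "cotangent_lift A g (f q, P) = (q, P')"
    by (metis fst_cotangent_lift fst_conv prod.collapse gf[OF qU])
  have in3: "(q, P') \<in> cotangent_bundle A"
    using lift_in_bundle[OF r g in2] by (simp only: P')
  obtain c d where c: "c \<in> A" "q \<in> cdom c" and d: "d \<in> A" "f q \<in> cdom d"
    using in1 in2 by (auto simp: cotangent_bundle_def underlying_set_def)
  have gc: "g (f q) \<in> cdom c" using c gf[OF qU] by simp
  have fm: "Cr_map r A A f" and gm: "Cr_map r A A g" using f g by (simp_all add: diffeomorphism_def)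
  have 1: "p c = transpose (chart_jacobian f c d q) *v P d"
    using cotangent_lift_coords[OF r man s f in1 c d] by (simp only: P snd_conv)
  have 2: "P d = transpose (chart_jacobian g d c (f q)) *v P' c"
    using cotangent_lift_coords[OF r man s g in2 d c(1) gc] by (simp only: P' snd_conv)
  have "chart_jacobian (g \<circ> f) c c q = chart_jacobian g d c (f q) ** chart_jacobian f c d q"
    by (rule jacobian_compose[OF chart_inj[OF c(1)] chart_inj[OF d(1)] c(2) d(2)
          open_preimage_chart_image[OF man fm c(1) d(1)]
          Cr_map_differentiable[OF fm r c(1) d(1) c(2) d(2)]
          Cr_map_differentiable[OF gm r d(1) c(1) d(2) gc]])
  moreover have "chart_jacobian (g \<circ> f) c c q = chart_jacobian id c c q"
    by (rule jacobian_cong[OF chart_open[OF c(1)] chart_inj[OF c(1)] c(2)])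
      (use gf c in \<open>auto simp: underlying_set_def\<close>)
  ultimately have "chart_jacobian g d c (f q) ** chart_jacobian f c d q = mat 1"
    using jacobian_id[OF chart_open[OF c(1)] chart_inj[OF c(1)] c(2)] by simp
  then have "p c = P' c"
    unfolding 1 2 by (simp only: matrix_vector_mul_assoc matrix_transpose_mul[symmetric]
        transpose_mat matrix_vector_mul_lid)
  then have "p = P'" by (rule cotangent_bundle_eqI[OF in1 in3 c])
  then show ?thesis unfolding y_eq P P' by simp
qed

text \<open>The original covector is the lift under \<open>g\<close> of the lifted one, so the
  coordinate identity for \<open>g\<close> gives the new covector explicitly.\<close>

lemma snd_cotangent_lift:
  assumes r: "r \<noteq> C_fin 0" and f: "diffeomorphism r A A f" and g: "diffeomorphism r A A g"
    and gf: "\<And>q. q \<in> underlying_set A \<Longrightarrow> g (f q) = q"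
    and y: "(q, p) \<in> cotangent_bundle A" and c: "c \<in> A" "q \<in> cdom c" and d: "d \<in> A" "f q \<in> cdom d"
  shows "snd (cotangent_lift A f (q, p)) d = transpose (chart_jacobian g d c (f q)) *v p c"
proof -
  obtain P where P: "cotangent_lift A f (q, p) = (f q, P)"
    by (metis fst_cotangent_lift fst_conv prod.collapse)
  have in2: "(f q, P) \<in> cotangent_bundle A"
    using lift_in_bundle[OF r f y] by (simp add: P)
  have "g (f q) \<in> cdom c" using gf y c by (simp add: cotangent_bundle_def)
  from cotangent_lift_coords[OF r man s g in2 d c(1) this]
  show ?thesis
    using cotangent_lift_left_inverse[OF r f g gf y] by (simp only: P snd_conv)
qed

lemma cotangent_lift_in_chart:
  assumes r: "r \<noteq> C_fin 0" and f: "diffeomorphism r A A f" and g: "diffeomorphism r A A g"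
    and gf: "\<And>q. q \<in> underlying_set A \<Longrightarrow> g (f q) = q"
    and c: "c \<in> A" and d: "d \<in> A" and z: "z \<in> cmap c ` {q \<in> cdom c. f q \<in> cdom d} \<times> UNIV"
  shows "(cmap (cotangent_chart A d) \<circ> cotangent_lift A f \<circ> cinv (cotangent_chart A c)) z =
    ((cmap d \<circ> f \<circ> cinv c) (fst z),
     \<Sum>b\<in>Basis. (snd z \<bullet> frechet_derivative (cmap c \<circ> g \<circ> cinv d)
       (at ((cmap d \<circ> f \<circ> cinv c) (fst z))) b) *\<^sub>R b)"
proof -
  obtain q where q: "q \<in> cdom c" "f q \<in> cdom d" "fst z = cmap c q" using z by auto
  have z': "z \<in> cmap c ` cdom c \<times> UNIV" using z by auto
  obtain p where p: "cinv (cotangent_chart A c) z = (cinv c (fst z), p)" "p c = snd z"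
    "(cinv c (fst z), p) \<in> cotangent_bundle A"
    by (rule cotangent_cinv[OF c z'])
  have iq: "cinv c (fst z) = q" using q chart_inj[OF c] by simp
  have gq: "g (f q) \<in> cdom c" using gf[OF in_underlying_set[OF c q(1)]] q by simp
  let ?G = "cmap c \<circ> g \<circ> cinv d"
  have gm: "Cr_map r A A g" using g by (simp add: diffeomorphism_def)
  have lin: "linear (frechet_derivative ?G (at (cmap d (f q))))"
    by (rule linear_frechet_derivative[OF Cr_map_differentiable[OF gm r d c q(2) gq]])
  have "cotangent_lift A f (q, p) = (f q, snd (cotangent_lift A f (q, p)))"
    using fst_cotangent_lift[of f "(q, p)"] by (simp add: prod_eq_iff)
  then have "cmap (cotangent_chart A d) (cotangent_lift A f (q, p)) =
      (cmap d (f q), snd (cotangent_lift A f (q, p)) d)"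
    using cotangent_cmap by metis
  also have "snd (cotangent_lift A f (q, p)) d = transpose (chart_jacobian g d c (f q)) *v p c"
    by (rule snd_cotangent_lift[OF r f g _ p(3)[unfolded iq] c q(1) d q(2)]) (rule gf)
  also have "\<dots> =
      (\<Sum>b\<in>Basis. (snd z \<bullet> frechet_derivative ?G (at (cmap d (f q))) b) *\<^sub>R b)"
    unfolding chart_jacobian_def p(2) by (rule transpose_matrix_mult[OF lin])
  finally show ?thesis by (simp only: comp_apply p(1) iq)
qed

text \<open>The chart representation of the lift involves the derivative of the inverse diffeomorphism, so
  that no matrix inverse has to be differentiated.\<close>

lemma cotangent_lift_smooth:
  assumes f: "diffeomorphism (C_fin (Suc k)) A A f" and g: "diffeomorphism (C_fin (Suc k)) A A g"
    and gf: "\<And>q. q \<in> underlying_set A \<Longrightarrow> g (f q) = q"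
    and c: "c \<in> A" and d: "d \<in> A"
  shows "k_times_cont_diff_on k (cmap c ` {q \<in> cdom c. f q \<in> cdom d} \<times> UNIV)
    (cmap (cotangent_chart A d) \<circ> cotangent_lift A f \<circ> cinv (cotangent_chart A c))"
proof -
  let ?S = "cmap c ` {q \<in> cdom c. f q \<in> cdom d}" and ?T = "cmap d ` {q \<in> cdom d. g q \<in> cdom c}"
  let ?F = "cmap d \<circ> f \<circ> cinv c" and ?G = "cmap c \<circ> g \<circ> cinv d"
  let ?O = "?S \<times> (UNIV :: (real^'n) set)"
  have fm: "Cr_map (C_fin (Suc k)) A A f" and gm: "Cr_map (C_fin (Suc k)) A A g"
    using f g unfolding diffeomorphism_def by blast+
  have S: "open ?S" by (rule open_preimage_chart_image[OF man fm c d])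
  then have O: "open ?O" by (simp add: open_Times)
  have kF: "k_times_cont_diff_on (Suc k) ?S ?F" and kG: "k_times_cont_diff_on (Suc k) ?T ?G"
    using fm gm c d unfolding Cr_map_def Cr_on.simps by blast+
  have kF': "k_times_cont_diff_on k ?S ?F" by (rule k_times_cont_diff_on_SucD[OF kF])
  have FT: "?F ` ?S \<subseteq> ?T"
  proof
    fix y assume "y \<in> ?F ` ?S"
    then obtain q where q: "q \<in> cdom c" "f q \<in> cdom d" "y = cmap d (f q)"
      using chart_inj[OF c] by auto
    moreover have "g (f q) = q" by (rule gf[OF in_underlying_set[OF c q(1)]])
    ultimately show "y \<in> ?T" by (intro image_eqI[of _ _ "f q"]) simp_all
  qed
  have w: "k_times_cont_diff_on k ?O
      (\<lambda>z. (snd z \<bullet> frechet_derivative ?G (at (?F (fst z))) b) *\<^sub>R b)" for b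
  proof -
    \<comment> \<open>The loss of one order comes from here: the derivative of a map of class
      \<open>Suc k\<close> has class \<open>k\<close>.\<close>
    have "k_times_cont_diff_on k ?T (\<lambda>y. frechet_derivative ?G (at y) b)"
      using kG by (simp only: k_times_cont_diff_on.simps)
    then have "k_times_cont_diff_on k ?S (\<lambda>x. frechet_derivative ?G (at (?F x)) b)"
      by (rule k_times_cont_diff_on_comp[OF S _ kF' FT])
    then have "k_times_cont_diff_on k ?O (\<lambda>z. frechet_derivative ?G (at (?F (fst z))) b)"
      by (rule k_times_cont_diff_on_fst[OF S])
    then have "k_times_cont_diff_on k ?O
        (\<lambda>z. snd z \<bullet> frechet_derivative ?G (at (?F (fst z))) b)"
      by (rule k_times_cont_diff_on_bilinear[OF bounded_bilinear_inner O
            k_times_cont_diff_on_linear[OF bounded_linear_snd]])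
    then show ?thesis
      by (rule k_times_cont_diff_on_linear_comp[OF bounded_linear_scaleR_left O])
  qed
  have "k_times_cont_diff_on k ?O (\<lambda>z. (?F (fst z),
      \<Sum>b\<in>Basis. (snd z \<bullet> frechet_derivative ?G (at (?F (fst z))) b) *\<^sub>R b))"
    by (rule k_times_cont_diff_on_Pair[OF O k_times_cont_diff_on_fst[OF S kF']
          k_times_cont_diff_on_sum[OF O w]])
  then show ?thesis
    by (rule k_times_cont_diff_on_cong[OF O])
      (rule cotangent_lift_in_chart[OF _ f g gf c d, symmetric], simp)
qed

text \<open>Since the lift covers \<open>f\<close>, membership in the target chart depends only on
  the base point. The map \<open>h\<close> agrees with the lift on the bundle only, so that the
  \<open>inv_into\<close> of another lift can take its place.\<close>

lemma cotangent_lift_domain: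
  assumes r: "r \<noteq> C_fin 0" and f: "diffeomorphism r A A f" and c: "c \<in> A"
    and h: "\<And>y. y \<in> cotangent_bundle A \<Longrightarrow> h y = cotangent_lift A f y"
  shows "cmap (cotangent_chart A c) `
      {y \<in> cdom (cotangent_chart A c). h y \<in> cdom (cotangent_chart A d)} =
    cmap c ` {q \<in> cdom c. f q \<in> cdom d} \<times> UNIV"
proof -
  have "h y \<in> cdom (cotangent_chart A d) \<longleftrightarrow> f (fst y) \<in> cdom d"
    if "y \<in> cdom (cotangent_chart A c)" for y
  proof -
    have y: "y \<in> cotangent_bundle A" using that by (simp add: cotangent_chart_def)
    show ?thesis
      using lift_in_bundle[OF r f y] by (simp add: h[OF y] cotangent_chart_def fst_cotangent_lift)
  qed
  then have "{y \<in> cdom (cotangent_chart A c). h y \<in> cdom (cotangent_chart A d)} =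
      {y \<in> cdom (cotangent_chart A c). f (fst y) \<in> cdom d}" by blast
  then show ?thesis
    using cotangent_chart_image[OF c, of "\<lambda>q. f q \<in> cdom d"] by simp
qed

lemma cotangent_lift_Cr_map:
  assumes f: "diffeomorphism (C_fin (Suc k)) A A f" and g: "diffeomorphism (C_fin (Suc k)) A A g"
    and gf: "\<And>q. q \<in> underlying_set A \<Longrightarrow> g (f q) = q"
    and h: "\<And>y. y \<in> cotangent_bundle A \<Longrightarrow> h y = cotangent_lift A f y"
  shows "Cr_map (C_fin k) (cotangent_atlas A) (cotangent_atlas A) h"
proof -
  have r: "C_fin (Suc k) \<noteq> C_fin 0" by simp
  have fm: "Cr_map (C_fin (Suc k)) A A f" using f unfolding diffeomorphism_def by blast
  have dom: "cmap (cotangent_chart A c) `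
      {y \<in> cdom (cotangent_chart A c). h y \<in> cdom (cotangent_chart A d)} =
    cmap c ` {q \<in> cdom c. f q \<in> cdom d} \<times> UNIV" if "c \<in> A" for c d
    by (rule cotangent_lift_domain[OF r f that]) (rule h)
  have op: "open (cmap c ` {q \<in> cdom c. f q \<in> cdom d} \<times> (UNIV :: (real^'n) set))"
    if "c \<in> A" "d \<in> A" for c d
    using open_preimage_chart_image[OF man fm that] by (simp add: open_Times)
  have smooth: "k_times_cont_diff_on k (cmap c ` {q \<in> cdom c. f q \<in> cdom d} \<times> UNIV)
      (cmap (cotangent_chart A d) \<circ> h \<circ> cinv (cotangent_chart A c))" if c: "c \<in> A" and d: "d \<in> A" for c d
  proof (rule k_times_cont_diff_on_cong[OF op[OF c d] cotangent_lift_smooth[OF f g gf c d]])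
    fix z assume "z \<in> cmap c ` {q \<in> cdom c. f q \<in> cdom d} \<times> (UNIV :: (real^'n) set)"
    then have "z \<in> cmap c ` cdom c \<times> UNIV" by auto
    from cotangent_cinv[OF c this] have "cinv (cotangent_chart A c) z \<in> cotangent_bundle A"
      by metis
    then show "(cmap (cotangent_chart A d) \<circ> cotangent_lift A f \<circ> cinv (cotangent_chart A c)) z =
        (cmap (cotangent_chart A d) \<circ> h \<circ> cinv (cotangent_chart A c)) z"
      by (simp add: h)
  qed
  have "continuous_map (atlas_topology (cotangent_atlas A)) (atlas_topology (cotangent_atlas A)) h"
  proof (rule continuous_map_atlasI)
    fix C assume "C \<in> cotangent_atlas A"
    then show "inj_on (cmap C) (cdom C)"
      using cotangent_chart_inj by (auto simp: cotangent_atlas_def)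
  next
    fix y assume "y \<in> underlying_set (cotangent_atlas A)"
    then show "h y \<in> underlying_set (cotangent_atlas A)"
      using lift_in_bundle[OF r f] by (simp add: underlying_cotangent_atlas h)
  next
    fix C D assume "C \<in> cotangent_atlas A" "D \<in> cotangent_atlas A"
    then obtain c d where *: "c \<in> A" "d \<in> A" "C = cotangent_chart A c" "D = cotangent_chart A d"
      unfolding cotangent_atlas_def by blast
    show "open (cmap C ` {q \<in> cdom C. h q \<in> cdom D})"
      "continuous_on (cmap C ` {q \<in> cdom C. h q \<in> cdom D}) (cmap D \<circ> h \<circ> cinv C)"
      unfolding *(3,4) dom[OF *(1)]
      using op[OF *(1,2)] Cr_on_continuous[of "C_fin k", unfolded Cr_on.simps, OF smooth[OF *(1,2)]]
      by blast+
  qed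
  moreover have "Cr_on (C_fin k) (cmap C ` {q \<in> cdom C. h q \<in> cdom D}) (cmap D \<circ> h \<circ> cinv C)"
    if CT: "C \<in> cotangent_atlas A" "D \<in> cotangent_atlas A" for C D
  proof -
    obtain c d where *: "c \<in> A" "d \<in> A" "C = cotangent_chart A c" "D = cotangent_chart A d"
      using CT unfolding cotangent_atlas_def by blast
    show ?thesis
      unfolding *(3,4) dom[OF *(1)] Cr_on.simps by (rule smooth[OF *(1,2)])
  qed
  ultimately show ?thesis unfolding Cr_map_def by blast
qed

lemma diffeomorphism_cotangent_lift:
  assumes f: "diffeomorphism (C_fin (Suc k)) A A f"
  shows "diffeomorphism (C_fin k) (cotangent_atlas A) (cotangent_atlas A) (cotangent_lift A f)"
proof -
  let ?U = "underlying_set A"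
  define g where "g = inv_into ?U f"
  have r: "C_fin (Suc k) \<noteq> C_fin 0" by simp
  have g: "diffeomorphism (C_fin (Suc k)) A A g"
    unfolding g_def by (rule diffeomorphism_inverse[OF man f])
  have bij: "bij_betw f ?U ?U" using f by (simp add: diffeomorphism_def)
  have gf: "g (f q) = q" and fg: "f (g q) = q" if "q \<in> ?U" for q
    using bij that by (simp_all add: g_def bij_betw_inv_into_left bij_betw_inv_into_right)
  let ?T = "cotangent_bundle A" and ?lf = "cotangent_lift A f" and ?lg = "cotangent_lift A g"
  have lgf: "?lg (?lf y) = y" and lfg: "?lf (?lg y) = y" if "y \<in> ?T" for y
    using cotangent_lift_left_inverse[OF r f g _ that] cotangent_lift_left_inverse[OF r g f _ that]
      gf fg by blast+
  have bijT: "bij_betw ?lf ?T ?T"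
    using lgf lfg lift_in_bundle[OF r f] lift_in_bundle[OF r g]
    by (intro bij_betw_byWitness[of _ ?lg]) auto
  have inv: "inv_into ?T ?lf y = ?lg y" if "y \<in> ?T" for y
    using bij_betw_imp_inj_on[OF bijT] lift_in_bundle[OF r g that] lfg[OF that]
    by (rule inv_into_f_eq)
  have "Cr_map (C_fin k) (cotangent_atlas A) (cotangent_atlas A) ?lf"
    by (rule cotangent_lift_Cr_map[OF f g _ refl]) (rule gf)
  moreover have "Cr_map (C_fin k) (cotangent_atlas A) (cotangent_atlas A) (inv_into ?T ?lf)"
    by (rule cotangent_lift_Cr_map[OF g f]) (simp_all only: fg inv)
  ultimately show ?thesis
    using bijT unfolding diffeomorphism_def underlying_cotangent_atlas by blast
qed

text \<open>In a chart the lift is \<open>(x, p) \<mapsto> (F x, P)\<close> with \<open>P \<bullet> DF(x) v = p \<bullet> v\<close>. Differentiating this identity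
  produces the canonical form up to a second derivative of \<open>F\<close>, which cancels by symmetry.\<close>

lemma preserves_canonical_form_cotangent_lift:
  assumes f: "diffeomorphism (C_fin 2) A A f"
  shows "preserves_canonical_form A (cotangent_lift A f)"
proof -
  let ?lf = "cotangent_lift A f"
  have r: "C_fin 2 \<noteq> C_fin 0" by simp
  have fm: "Cr_map (C_fin 2) A A f" using f by (simp add: diffeomorphism_def)
  \<comment> \<open>With \<open>f\<close> of class 2 the lift has class 1, so \<open>L\<close> below
    is a genuine derivative.\<close>
  have lift1: "Cr_map (C_fin 1) (cotangent_atlas A) (cotangent_atlas A) ?lf"
    using diffeomorphism_cotangent_lift[of 1 f] f unfolding diffeomorphism_def
    by (simp add: numeral_2_eq_2)
  have main: "canonical_form (L a) (L b) = canonical_form a b"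
    if c: "c \<in> A" and d: "d \<in> A" and y: "y \<in> cdom (cotangent_chart A c)"
      and ly: "?lf y \<in> cdom (cotangent_chart A d)"
      and L: "L = frechet_derivative (cmap (cotangent_chart A d) \<circ> ?lf \<circ> cinv (cotangent_chart A c))
        (at (cmap (cotangent_chart A c) y))" for c d y L a b
  proof -
    let ?C = "cotangent_chart A c" and ?D = "cotangent_chart A d"
    let ?Psi = "cmap ?D \<circ> ?lf \<circ> cinv ?C" and ?F = "cmap d \<circ> f \<circ> cinv c"
    let ?S = "cmap c ` {q \<in> cdom c. f q \<in> cdom d}"
    let ?z = "cmap ?C y"
    let ?O = "?S \<times> (UNIV :: (real^'n) set)"
    let ?DF = "\<lambda>x. frechet_derivative ?F (at x)"
    let ?H = "\<lambda>v. frechet_derivative (\<lambda>x. ?DF x v) (at (fst ?z))"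
    have S: "open ?S" by (rule open_preimage_chart_image[OF man fm c d])
    then have O: "open ?O" by (simp add: open_Times)
    have zO: "?z \<in> ?O"
      using cotangent_lift_domain[OF r f c refl, of d] y ly by blast
    then have xS: "fst ?z \<in> ?S" by auto
    have kF: "k_times_cont_diff_on 2 ?S ?F"
      using fm c d unfolding Cr_map_def Cr_on.simps by blast
    have dF: "?F differentiable (at x)"
      and dDF: "(\<lambda>x. ?DF x v) differentiable (at x)" if "x \<in> ?S" for x v
      using kF that unfolding numeral_2_eq_2 k_times_cont_diff_on.simps by blast+
    have DH: "((\<lambda>x. ?DF x v) has_derivative ?H v) (at (fst ?z))" for v
      using dDF[OF xS] unfolding frechet_derivative_works .
    have DL: "(?Psi has_derivative L) (at ?z)"
      unfolding L frechet_derivative_works[symmetric]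
      by (rule Cr_map_differentiable[OF lift1]) (use c d y ly in \<open>auto simp: cotangent_atlas_def\<close>)
    have fstPsi: "fst (?Psi z) = ?F (fst z)" and pairing: "snd (?Psi z) \<bullet> ?DF (fst z) v = snd z \<bullet> v"
      if zO: "z \<in> ?O" for z v
    proof -
      obtain q where q: "q \<in> cdom c" "f q \<in> cdom d" "fst z = cmap c q" using zO by auto
      have z': "z \<in> cmap c ` cdom c \<times> UNIV" using zO by auto
      obtain p where p: "cinv ?C z = (cinv c (fst z), p)" "p c = snd z"
        "(cinv c (fst z), p) \<in> cotangent_bundle A"
        by (rule cotangent_cinv[OF c z'])
      have iq: "cinv c (fst z) = q" using q chart_inj[OF c] by simp
      have lift: "?lf (q, p) = (f q, snd (?lf (q, p)))"
        using fst_cotangent_lift[of f "(q, p)"] by (simp add: prod_eq_iff)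
      then have Psi: "?Psi z = (cmap d (f q), snd (?lf (q, p)) d)"
        using cotangent_cmap[of d "f q" "snd (?lf (q, p))"] by (simp only: comp_apply p(1) iq)
      then show "fst (?Psi z) = ?F (fst z)" by (simp only: fst_conv comp_apply iq)
      have "snd z = transpose (chart_jacobian f c d q) *v snd (?lf (q, p)) d"
        using cotangent_lift_coords[OF r man s f p(3)[unfolded iq] c q(1) d q(2)] p(2) by simp
      then have "snd z \<bullet> v = snd (?Psi z) \<bullet> (chart_jacobian f c d q *v v)"
        by (simp only: inner_transpose_mult Psi snd_conv)
      also have "chart_jacobian f c d q *v v = ?DF (fst z) v"
        unfolding q(3) by (rule chart_jacobian_mult[OF dF]) (use q in blast)
      finally show "snd (?Psi z) \<bullet> ?DF (fst z) v = snd z \<bullet> v" ..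
    qed
    have fstL: "fst (L a) = ?DF (fst ?z) (fst a)" for a
    proof -
      have "((\<lambda>z. fst (?Psi z)) has_derivative (\<lambda>a. fst (L a))) (at ?z)"
        by (rule has_derivative_fst[OF DL])
      then have 1: "((\<lambda>z. ?F (fst z)) has_derivative (\<lambda>a. fst (L a))) (at ?z)"
        by (rule has_derivative_transform_within_open[OF _ O zO]) (rule fstPsi)
      have 2: "((\<lambda>z. ?F (fst z)) has_derivative (\<lambda>a. ?DF (fst ?z) (fst a))) (at ?z)"
        by (rule has_derivative_compose[OF has_derivative_fst[OF has_derivative_ident]])
          (use dF[OF xS] frechet_derivative_works in blast)
      show ?thesis using has_derivative_unique[OF 1 2] by metis
    qed
    have key: "snd (?Psi ?z) \<bullet> ?H v (fst a) + snd (L a) \<bullet> ?DF (fst ?z) v = snd a \<bullet> v" for a v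
    proof -
      have 1: "((\<lambda>z. ?DF (fst z) v) has_derivative (\<lambda>a. ?H v (fst a))) (at ?z)"
        by (rule has_derivative_compose[OF has_derivative_fst[OF has_derivative_ident] DH])
      have "((\<lambda>z. snd (?Psi z) \<bullet> ?DF (fst z) v) has_derivative
          (\<lambda>a. snd (?Psi ?z) \<bullet> ?H v (fst a) + snd (L a) \<bullet> ?DF (fst ?z) v)) (at ?z)"
        by (rule has_derivative_inner[OF has_derivative_snd[OF DL] 1])
      then have 2: "((\<lambda>z. snd z \<bullet> v) has_derivative
          (\<lambda>a. snd (?Psi ?z) \<bullet> ?H v (fst a) + snd (L a) \<bullet> ?DF (fst ?z) v)) (at ?z)"
        by (rule has_derivative_transform_within_open[OF _ O zO]) (rule pairing)
      have 3: "((\<lambda>z. snd z \<bullet> v) has_derivative (\<lambda>a. snd a \<bullet> v)) (at ?z)"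
        by (rule has_derivative_inner_left[OF has_derivative_snd[OF has_derivative_ident]])
      show ?thesis using has_derivative_unique[OF 2 3] by metis
    qed
    have sym: "?H v w = ?H w v" for v w
      by (rule second_derivative_symmetric_vector[OF S kF xS])
    have cf: "canonical_form a b = snd a \<bullet> fst b - snd b \<bullet> fst a" for a b :: "(real^'n) \<times> (real^'n)"
      by (simp add: canonical_form_def inner_vec_def sum_subtractf)
    \<comment> \<open>The identity \<open>key\<close> is used with \<open>v = fst b\<close> in
      direction \<open>a\<close> and with \<open>v = fst a\<close> in direction \<open>b\<close>. In
      the difference the terms with \<open>?H\<close> cancel by \<open>sym\<close>; the form of the
      images remains on one side and that of \<open>a\<close> and \<open>b\<close> on the
      other.\<close>
    show ?thesis
      unfolding cf fstL using key[of "fst b" a] key[of "fst a" b] sym[of "fst a" "fst b"] by simp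
  qed
  show ?thesis
    unfolding preserves_canonical_form_def Let_def
  proof (intro ballI impI allI)
    fix C D y a b assume "C \<in> cotangent_atlas A" "D \<in> cotangent_atlas A" and
      y: "y \<in> cdom C" "?lf y \<in> cdom D"
    then obtain c d where *: "c \<in> A" "d \<in> A" "C = cotangent_chart A c" "D = cotangent_chart A d"
      unfolding cotangent_atlas_def by blast
    show "canonical_form (frechet_derivative (cmap D \<circ> ?lf \<circ> cinv C) (at (cmap C y)) a)
        (frechet_derivative (cmap D \<circ> ?lf \<circ> cinv C) (at (cmap C y)) b) = canonical_form a b"
      using main[OF *(1,2) y[unfolded *(3,4)] refl] unfolding *(3,4) .
  qed
qed

end

text \<open>The last two clauses reflect the lost derivative: class 1 of \<open>f\<close> makes the
  lift a homeomorphism, and its derivative, hence the canonical form, is treated from class 2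
  on.\<close>

theorem proposition5p4:
  fixes A :: "('a, real^'n::finite) chart set" and f :: "'a \<Rightarrow> 'a" and r :: regularity
  assumes "r \<noteq> C_fin 0"
    and "manifold (if r = C_omega then C_omega else C_infinity) A"
    and "diffeomorphism r A A f"
    and "Cr_integrable r A f"
  shows "Cr_symplectic_integrable r A (cotangent_lift A f) \<and>
    diffeomorphism (C_fin 0) (cotangent_atlas A) (cotangent_atlas A) (cotangent_lift A f) \<and>
    (r \<noteq> C_fin 1 \<longrightarrow> symplectic_diffeomorphism A (cotangent_lift A f))"
proof -
  note r = assms(1) and f = assms(3)
  define s where "s = (if r = C_omega then C_omega else C_infinity)"
  interpret smooth_atlas A s
    by standard (use assms(2) in \<open>auto simp: s_def\<close>)
  obtain m where "Cr_integrable_with r A m f" using assms(4) by (auto simp: Cr_integrable_def)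
  then obtain X F where m: "m \<le> CARD('n)" and fm: "Cr_map r A A f"
    and X: "\<forall>j<m. Cr_vector_field r A (X j)"
    and F: "\<forall>k<CARD('n) - m. Cr_function r A (F k)"
    and Xi: "vector_fields_independent_ae A m X"
    and lie: "\<forall>i<m. \<forall>j<m. \<forall>c\<in>A. \<forall>q\<in>cdom c. lie_bracket (X i) (X j) q c = 0"
    and Fi: "differentials_independent_ae A (CARD('n) - m) F"
    and der: "\<forall>k<CARD('n) - m. \<forall>j<m. \<forall>c\<in>A. \<forall>q\<in>cdom c. derivation_along (X j) (F k) q c = 0"
    and flow: "\<forall>j<m. \<exists>\<phi>. is_flow A (X j) \<phi> \<and>
      (\<forall>t. \<forall>q\<in>underlying_set A. f (\<phi> t q) = \<phi> t (f q))"
    and Finv: "\<forall>k<CARD('n) - m. \<forall>q\<in>underlying_set A. F k (f q) = F k q"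
    unfolding Cr_integrable_with_def by (elim conjE exE) (rule that)
  define G where "G j = (if j < m then momentum (X j) else F (j - m) \<circ> fst)" for j
  have Gsmooth: "Cr_function r (cotangent_atlas A) (G j)" if "j < CARD('n)" for j
    using that X F by (simp add: G_def Cr_function_momentum Cr_function_base)
  have Ginv: "G j (cotangent_lift A f y) = G j y"
    if j: "j < CARD('n)" and y: "y \<in> cotangent_bundle A" for j y
  proof (cases "j < m")
    case True
    then obtain \<phi> where \<phi>: "is_flow A (X j) \<phi>"
      "\<And>t q. q \<in> underlying_set A \<Longrightarrow> f (\<phi> t q) = \<phi> t (f q)" using flow by blast
    have "vector_field A (X j)" using X True by (auto simp: Cr_vector_field_def)
    then have "momentum (X j) (cotangent_lift A f y) = momentum (X j) y"
      by (rule momentum_cotangent_lift[OF r f _ flow_commute_imp_invariant[OF r man fm \<phi>] y])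
    then show ?thesis by (simp add: G_def True)
  next
    case False
    have "fst y \<in> underlying_set A" using y by (auto simp: cotangent_bundle_def)
    then show ?thesis using False j Finv by (simp add: G_def fst_cotangent_lift)
  qed
  have "differentials_independent_ae (cotangent_atlas A) (m + (CARD('n) - m)) G"
    unfolding G_def[abs_def]
    by (rule differentials_independent_ae_cotangent[OF r _ _ Xi Fi]) (use X F in auto)
  \<comment> \<open>By \<open>m \<le> CARD('n)\<close> the truncated subtraction is exact and the
    two blocks have \<open>CARD('n)\<close> members together.\<close>
  then have Gindep: "differentials_independent_ae (cotangent_atlas A) CARD('n) G"
    using m by simp
  have Gpoisson: "poisson_bracket C (G j) (G k) y = 0"
    if j: "j < CARD('n)" and k: "k < CARD('n)" and CT: "C \<in> cotangent_atlas A" and y: "y \<in> cdom C"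
    for j k C y
  proof -
    obtain c where c: "c \<in> A" and C: "C = cotangent_chart A c"
      using CT unfolding cotangent_atlas_def by blast
    obtain q p where yq: "y = (q, p)" by fastforce
    have q: "(q, p) \<in> cotangent_bundle A" "q \<in> cdom c"
      using y by (simp_all add: C yq in_cotangent_cdom)
    have mixed: "poisson_bracket C (momentum (X i)) (F l \<circ> fst) y = 0"
      if "i < m" "l < CARD('n) - m" for i l
      using poisson_momentum_base[OF r _ _ c q] X F der that c q by (simp add: C yq)
    consider "j < m" "k < m" | "j < m" "\<not> k < m" | "\<not> j < m" "k < m" | "\<not> j < m" "\<not> k < m"
      by blast
    then show ?thesis
    proof cases
      case 1
      then show ?thesis
        using poisson_momentum_momentum[OF r _ _ c q] X lie c q by (simp add: G_def C yq)
    next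
      case 2
      then show ?thesis using mixed k by (simp add: G_def)
    next
      case 3
      then show ?thesis
        using mixed j poisson_bracket_antisym[of C "G j" "G k" y] by (simp add: G_def)
    next
      case 4
      then show ?thesis
        using poisson_base_base[OF r _ _ c q(2)] F j k by (simp add: G_def C yq)
    qed
  qed
  have "Cr_symplectic_integrable r A (cotangent_lift A f)"
    unfolding Cr_symplectic_integrable_def using Gsmooth Ginv Gindep Gpoisson by blast
  moreover have "diffeomorphism (C_fin (Suc 0)) A A f"
    using r by (intro diffeomorphism_C_fin[OF f]) auto
  then have "diffeomorphism (C_fin 0) (cotangent_atlas A) (cotangent_atlas A) (cotangent_lift A f)"
    by (rule diffeomorphism_cotangent_lift)
  moreover have "symplectic_diffeomorphism A (cotangent_lift A f)" if "r \<noteq> C_fin 1"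
  proof -
    \<comment> \<open>A finite class other than 0 and 1 is at least 2; for the smooth and analytic
      classes the condition is vacuous.\<close>
    have "2 \<le> k" if "r = C_fin k" for k
      using r \<open>r \<noteq> C_fin 1\<close> that by (cases k rule: nat.exhaust) (auto simp: Suc_le_eq numeral_2_eq_2)
    then have f2: "diffeomorphism (C_fin 2) A A f"
      by (rule diffeomorphism_C_fin[OF f])
    then have "diffeomorphism (C_fin (Suc 1)) A A f" by (simp add: numeral_2_eq_2)
    from diffeomorphism_cotangent_lift[OF this] preserves_canonical_form_cotangent_lift[OF f2]
    show ?thesis by (simp only: symplectic_diffeomorphism_def)
  qed
  ultimately show ?thesis by blast
qed

end
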